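(* Let $M$ be an invariant submanifold of a generalized Sasakian-space-form $\overline{M}^{2n+1}(f_1,f_2,f_3)$ with $f_1\neq f_3$ and $r\neq 2n(2n+1)(f_1-f_3)$ at every point, where $r$ is the scalar curvature of $M$. Then $M$ is totally geodesic if and only if $M$ is concircularly semiparallel.
   Context: An almost contact metric manifold $(\overline M,\phi,\xi,\eta,g)$ is a Riemannian manifold $(\overline M,g)$ with a $(1,1)$-tensor field $\phi$, a vector field $\xi$ and a $1$-form $\eta$ such that $\phi^2X=-X+\eta(X)\xi$, $\phi\xi=0$, $\eta(\xi)=1$, $g(X,\xi)=\eta(X)$, $\eta(\phi X)=0$, $g(\phi X,\phi Y)=g(X,Y)-\eta(X)\eta(Y)$. Curvature convention: $R(X,Y)=[\nabla_X,\nabla_Y]-\nabla_{[X,Y]}$. A generalized Sasakian-space-form $\overline M^{2n+1}(f_1,f_2,f_3)$ is an almost contact metric manifold of dimension $2n+1$, $n>1$, with smooth functions $f_1,f_2,f_3$ on $\overline M$ such that the curvature tensor $\overline R$ of its Levi-Civita connection $\overline\nabla$ satisfies $\overline R(X,Y)Z=f_1\{g(Y,Z)X-g(X,Z)Y\}+f_2\{g(X,\phi Z)\phi Y-g(Y,\phi Z)\phi X+2g(X,\phi Y)\phi Z\}+f_3\{\eta(X)\eta(Z)Y-\eta(Y)\eta(Z)X+g(X,Z)\eta(Y)\xi-g(Y,Z)\eta(X)\xi\}.$ Throughout, the following structure equations also hold on $\overline M$: $(\overline\nabla_X\phi)(Y)=(f_1-f_3)[g(X,Y)\xi-\eta(Y)X]$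 and $\overline\nabla_X\xi=-(f_1-f_3)\phi X$. A submanifold $M$ of $\overline M$ is invariant if $\xi$ is tangent to $M$ and $\phi(TM)\subset TM$ at every point of $M$. $M$ carries the induced metric and Levi-Civita connection $\nabla$ with curvature tensor $R$, the normal connection $\nabla^\perp$ with curvature $R^\perp(X,Y)=[\nabla^\perp_X,\nabla^\perp_Y]-\nabla^\perp_{[X,Y]}$, and the second fundamental form $h$, with $\overline\nabla_XY=\nabla_XY+h(X,Y)$. $M$ is totally geodesic if $h=0$. The concircular curvature tensor of $M$ is $C(X,Y)Z=R(X,Y)Z-\frac{r}{2n(2n+1)}[g(Y,Z)X-g(X,Z)Y]$. $M$ is concircularly semiparallel if, for all $X,Y,Z,U$ tangent to $M$, $(\overline C(X,Y)\cdot h)(Z,U):=R^\perp(X,Y)h(Z,U)-h(C(X,Y)Z,U)-h(Z,C(X,Y)U)=0$. *)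

theory Defs
  imports "HOL-Analysis.Analysis"
begin

section \<open>Smooth manifolds\<close>

fun Ck_on :: "nat \<Rightarrow> 'e::real_normed_vector set \<Rightarrow> ('e \<Rightarrow> 'f::real_normed_vector) \<Rightarrow> bool" where
  "Ck_on 0 S f \<longleftrightarrow> continuous_on S f"
| "Ck_on (Suc k) S f \<longleftrightarrow>
     (\<forall>x\<in>S. f differentiable (at x)) \<and> (\<forall>v. Ck_on k S (\<lambda>x. frechet_derivative f (at x) v))"

text \<open>Only used for open sets S of a Euclidean space, where it means of class C-infinity.\<close>

definition smooth_on :: "'e::real_normed_vector set \<Rightarrow> ('e \<Rightarrow> 'f::real_normed_vector) \<Rightarrow> bool" where
  "smooth_on S f \<longleftrightarrow> (\<forall>k. Ck_on k S f)"

text \<open>A chart is a pair (domain, coordinate map). The underlying set of a manifold is a whole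
  type; its Hausdorff and second countability properties are type class constraints.\<close>

type_synonym ('m, 'a) chart = "'m set \<times> ('m \<Rightarrow> 'a)"

definition chart_inv :: "('m, 'a) chart \<Rightarrow> 'a \<Rightarrow> 'm" where
  "chart_inv c = inv_into (fst c) (snd c)"

definition smooth_manifold ::
  "('m::{second_countable_topology,t2_space}, 'a::euclidean_space) chart set \<Rightarrow> bool" where
  "smooth_manifold A \<longleftrightarrow>
     (\<Union>c\<in>A. fst c) = UNIV \<and>
     (\<forall>c\<in>A. open (fst c) \<and> open (snd c ` fst c) \<and>
            homeomorphism (fst c) (snd c ` fst c) (snd c) (chart_inv c)) \<and>
     (\<forall>c\<in>A. \<forall>d\<in>A. smooth_on (snd c ` (fst c \<inter> fst d)) (snd d \<circ> chart_inv c))"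

text \<open>At every point one chart around it is singled out. The tangent space at p is the model
  space: the vector v at p is the one whose components in the chart \<open>chart_at A p\<close> are v.
  Vector fields are functions from points to the model space, read in this way, so passing
  to the components in another chart involves the Jacobian of the transition map
  (\<open>components\<close> below).\<close>

definition chart_at :: "('m, 'a) chart set \<Rightarrow> 'm \<Rightarrow> ('m, 'a) chart" where
  "chart_at A p = (SOME c. c \<in> A \<and> p \<in> fst c)"

definition coord :: "('m, 'a) chart set \<Rightarrow> 'm \<Rightarrow> 'm \<Rightarrow> 'a" where
  "coord A p = snd (chart_at A p)"

definition coord_inv :: "('m, 'a) chart set \<Rightarrow> 'm \<Rightarrow> 'a \<Rightarrow> 'm" where
  "coord_inv A p = chart_inv (chart_at A p)"

definition smooth_near ::
  "('m::topological_space, 'a::euclidean_space) chart set \<Rightarrow> 'm \<Rightarrow> ('m \<Rightarrow> 'f::real_normed_vector) \<Rightarrow> bool"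
where
  "smooth_near A p F \<longleftrightarrow>
     (\<exists>W. open W \<and> p \<in> W \<and> W \<subseteq> fst (chart_at A p) \<and> smooth_on (coord A p ` W) (F \<circ> coord_inv A p))"

text \<open>Derivative at p of the (vector-valued) function F in the direction of the tangent vector v.\<close>

definition tderiv ::
  "('m, 'a::euclidean_space) chart set \<Rightarrow> 'm \<Rightarrow> 'a \<Rightarrow> ('m \<Rightarrow> 'f::real_normed_vector) \<Rightarrow> 'f" where
  "tderiv A p v F = frechet_derivative (F \<circ> coord_inv A p) (at (coord A p p)) v"

text \<open>Components, in the chart singled out at p, of the tangent vector v at q.\<close>

definition components :: "('m, 'a::euclidean_space) chart set \<Rightarrow> 'm \<Rightarrow> 'm \<Rightarrow> 'a \<Rightarrow> 'a" where
  "components A p q v = tderiv A q v (coord A p)"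

text \<open>The field with constant components v in the chart singled out at p; its value at p is v.
  For v in Basis these are the coordinate vector fields of that chart.\<close>

definition coord_field :: "('m, 'a::euclidean_space) chart set \<Rightarrow> 'm \<Rightarrow> 'a \<Rightarrow> 'm \<Rightarrow> 'a" where
  "coord_field A p v q = frechet_derivative (coord A q \<circ> coord_inv A p) (at (coord A p q)) v"

definition smooth_vf ::
  "('m::topological_space, 'a::euclidean_space) chart set \<Rightarrow> 'm \<Rightarrow> ('m \<Rightarrow> 'a) \<Rightarrow> bool" where
  "smooth_vf A p X \<longleftrightarrow> smooth_near A p (\<lambda>q. components A p q (X q))"

definition lie_bracket ::
  "('m, 'a::euclidean_space) chart set \<Rightarrow> ('m \<Rightarrow> 'a) \<Rightarrow> ('m \<Rightarrow> 'a) \<Rightarrow> 'm \<Rightarrow> 'a" where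
  "lie_bracket A X Y p =
     tderiv A p (X p) (\<lambda>q. components A p q (Y q)) - tderiv A p (Y p) (\<lambda>q. components A p q (X q))"

section \<open>Riemannian metrics, connections and curvature\<close>

text \<open>Fields are total functions of which only the germ at the point in question matters: all
  conditions below are imposed at each point p for all fields that are smooth near p.\<close>

definition riemannian_metric ::
  "('m::topological_space, 'a::euclidean_space) chart set \<Rightarrow> ('m \<Rightarrow> 'a \<Rightarrow> 'a \<Rightarrow> real) \<Rightarrow> bool" where
  "riemannian_metric A g \<longleftrightarrow>
     (\<forall>p. bilinear (g p)) \<and>
     (\<forall>p x y. g p x y = g p y x) \<and>
     (\<forall>p x. x \<noteq> 0 \<longrightarrow> g p x x > 0) \<and>
     (\<forall>p X Y. smooth_vf A p X \<longrightarrow> smooth_vf A p Y \<longrightarrow> smooth_near A p (\<lambda>q. g q (X q) (Y q)))"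

text \<open>\<open>D p x Y\<close> is the covariant derivative at p of the field Y along the tangent vector x at p.\<close>

definition affine_connection ::
  "('m::topological_space, 'a::euclidean_space) chart set \<Rightarrow> ('m \<Rightarrow> 'a \<Rightarrow> ('m \<Rightarrow> 'a) \<Rightarrow> 'a) \<Rightarrow> bool"
where
  "affine_connection A D \<longleftrightarrow>
     (\<forall>p Y. smooth_vf A p Y \<longrightarrow> linear (\<lambda>x. D p x Y)) \<and>
     (\<forall>p x Y Z. smooth_vf A p Y \<longrightarrow> smooth_vf A p Z \<longrightarrow>
        D p x (\<lambda>q. Y q + Z q) = D p x Y + D p x Z) \<and>
     (\<forall>p x f Y. smooth_near A p (f :: 'm \<Rightarrow> real) \<longrightarrow> smooth_vf A p Y \<longrightarrow>
        D p x (\<lambda>q. f q *\<^sub>R Y q) = tderiv A p x f *\<^sub>R Y p + f p *\<^sub>R D p x Y) \<and>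
     (\<forall>p X Y. smooth_vf A p X \<longrightarrow> smooth_vf A p Y \<longrightarrow> smooth_vf A p (\<lambda>q. D q (X q) Y))"

definition levi_civita ::
  "('m::topological_space, 'a::euclidean_space) chart set \<Rightarrow> ('m \<Rightarrow> 'a \<Rightarrow> 'a \<Rightarrow> real) \<Rightarrow>
   ('m \<Rightarrow> 'a \<Rightarrow> ('m \<Rightarrow> 'a) \<Rightarrow> 'a) \<Rightarrow> bool"
where
  "levi_civita A g D \<longleftrightarrow>
     affine_connection A D \<and>
     (\<forall>p X Y. smooth_vf A p X \<longrightarrow> smooth_vf A p Y \<longrightarrow>
        D p (X p) Y - D p (Y p) X = lie_bracket A X Y p) \<and>
     (\<forall>p x Y Z. smooth_vf A p Y \<longrightarrow> smooth_vf A p Z \<longrightarrow>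
        tderiv A p x (\<lambda>q. g q (Y q) (Z q)) = g p (D p x Y) (Z p) + g p (Y p) (D p x Z))"

text \<open>Curvature of a connection D on the tangent bundle or on another vector bundle over the
  manifold, with sections V.\<close>

definition curvature ::
  "('m, 'a::euclidean_space) chart set \<Rightarrow> ('m \<Rightarrow> 'a \<Rightarrow> ('m \<Rightarrow> 'v) \<Rightarrow> 'v::real_vector) \<Rightarrow>
   ('m \<Rightarrow> 'a) \<Rightarrow> ('m \<Rightarrow> 'a) \<Rightarrow> ('m \<Rightarrow> 'v) \<Rightarrow> 'm \<Rightarrow> 'v"
where
  "curvature A D X Y V p =
     D p (X p) (\<lambda>q. D q (Y q) V) - D p (Y p) (\<lambda>q. D q (X q) V) - D p (lie_bracket A X Y p) V"

definition orthonormal_frame :: "('a \<Rightarrow> 'a \<Rightarrow> real) \<Rightarrow> ('a::euclidean_space \<Rightarrow> 'a) \<Rightarrow> bool" where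
  "orthonormal_frame b e \<longleftrightarrow> (\<forall>i\<in>Basis. \<forall>j\<in>Basis. b (e i) (e j) = (if i = j then 1 else 0))"

text \<open>Trace of the Ricci tensor \<open>Ric(Y, Z) = trace (X \<mapsto> R(X, Y)Z)\<close>; the value depends neither on
  the orthonormal frame at p nor on the extension of its members to fields.\<close>

definition scalar_curvature ::
  "('m, 'a::euclidean_space) chart set \<Rightarrow> ('m \<Rightarrow> 'a \<Rightarrow> 'a \<Rightarrow> real) \<Rightarrow>
   ('m \<Rightarrow> 'a \<Rightarrow> ('m \<Rightarrow> 'a) \<Rightarrow> 'a) \<Rightarrow> 'm \<Rightarrow> real"
where
  "scalar_curvature A g D p =
     (let e = SOME e. orthonormal_frame (g p) e; E = (\<lambda>i. coord_field A p (e i))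
      in \<Sum>i\<in>Basis. \<Sum>j\<in>Basis. g p (curvature A D (E j) (E i) (E i) p) (e j))"

section \<open>Generalized Sasakian-space-forms\<close>

definition almost_contact_metric ::
  "('m::{second_countable_topology,t2_space}, 'a::euclidean_space) chart set \<Rightarrow>
   ('m \<Rightarrow> 'a \<Rightarrow> 'a) \<Rightarrow> ('m \<Rightarrow> 'a) \<Rightarrow> ('m \<Rightarrow> 'a \<Rightarrow> real) \<Rightarrow> ('m \<Rightarrow> 'a \<Rightarrow> 'a \<Rightarrow> real) \<Rightarrow> bool"
where
  "almost_contact_metric A \<phi> \<xi> \<eta> g \<longleftrightarrow>
     smooth_manifold A \<and> riemannian_metric A g \<and>
     (\<forall>p. linear (\<phi> p)) \<and> (\<forall>p X. smooth_vf A p X \<longrightarrow> smooth_vf A p (\<lambda>q. \<phi> q (X q))) \<and>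
     (\<forall>p. smooth_vf A p \<xi>) \<and>
     (\<forall>p. linear (\<eta> p)) \<and> (\<forall>p X. smooth_vf A p X \<longrightarrow> smooth_near A p (\<lambda>q. \<eta> q (X q))) \<and>
     (\<forall>p x. \<phi> p (\<phi> p x) = - x + \<eta> p x *\<^sub>R \<xi> p) \<and>
     (\<forall>p. \<phi> p (\<xi> p) = 0) \<and>
     (\<forall>p. \<eta> p (\<xi> p) = 1) \<and>
     (\<forall>p x. g p x (\<xi> p) = \<eta> p x) \<and>
     (\<forall>p x. \<eta> p (\<phi> p x) = 0) \<and>
     (\<forall>p x y. g p (\<phi> p x) (\<phi> p y) = g p x y - \<eta> p x * \<eta> p y)"

definition generalized_sasakian_space_form ::
  "nat \<Rightarrow> ('m::{second_countable_topology,t2_space}, 'a::euclidean_space) chart set \<Rightarrow>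
   ('m \<Rightarrow> 'a \<Rightarrow> 'a) \<Rightarrow> ('m \<Rightarrow> 'a) \<Rightarrow> ('m \<Rightarrow> 'a \<Rightarrow> real) \<Rightarrow> ('m \<Rightarrow> 'a \<Rightarrow> 'a \<Rightarrow> real) \<Rightarrow>
   ('m \<Rightarrow> 'a \<Rightarrow> ('m \<Rightarrow> 'a) \<Rightarrow> 'a) \<Rightarrow> ('m \<Rightarrow> real) \<Rightarrow> ('m \<Rightarrow> real) \<Rightarrow> ('m \<Rightarrow> real) \<Rightarrow> bool"
where
  "generalized_sasakian_space_form n A \<phi> \<xi> \<eta> g D f1 f2 f3 \<longleftrightarrow>
     n > 1 \<and> DIM('a) = 2 * n + 1 \<and>
     almost_contact_metric A \<phi> \<xi> \<eta> g \<and>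
     levi_civita A g D \<and>
     (\<forall>p. smooth_near A p f1 \<and> smooth_near A p f2 \<and> smooth_near A p f3) \<and>
     (\<forall>p X Y Z. smooth_vf A p X \<longrightarrow> smooth_vf A p Y \<longrightarrow> smooth_vf A p Z \<longrightarrow>
        curvature A D X Y Z p =
          f1 p *\<^sub>R (g p (Y p) (Z p) *\<^sub>R X p - g p (X p) (Z p) *\<^sub>R Y p)
        + f2 p *\<^sub>R (g p (X p) (\<phi> p (Z p)) *\<^sub>R \<phi> p (Y p)
                  - g p (Y p) (\<phi> p (Z p)) *\<^sub>R \<phi> p (X p)
                  + (2 * g p (X p) (\<phi> p (Y p))) *\<^sub>R \<phi> p (Z p))
        + f3 p *\<^sub>R ((\<eta> p (X p) * \<eta> p (Z p)) *\<^sub>R Y p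
                  - (\<eta> p (Y p) * \<eta> p (Z p)) *\<^sub>R X p
                  + (g p (X p) (Z p) * \<eta> p (Y p)) *\<^sub>R \<xi> p
                  - (g p (Y p) (Z p) * \<eta> p (X p)) *\<^sub>R \<xi> p))"

definition structure_equations ::
  "('m::topological_space, 'a::euclidean_space) chart set \<Rightarrow>
   ('m \<Rightarrow> 'a \<Rightarrow> 'a) \<Rightarrow> ('m \<Rightarrow> 'a) \<Rightarrow> ('m \<Rightarrow> 'a \<Rightarrow> real) \<Rightarrow> ('m \<Rightarrow> 'a \<Rightarrow> 'a \<Rightarrow> real) \<Rightarrow>
   ('m \<Rightarrow> 'a \<Rightarrow> ('m \<Rightarrow> 'a) \<Rightarrow> 'a) \<Rightarrow> ('m \<Rightarrow> real) \<Rightarrow> ('m \<Rightarrow> real) \<Rightarrow> bool"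
where
  "structure_equations A \<phi> \<xi> \<eta> g D f1 f3 \<longleftrightarrow>
     (\<forall>p x Y. smooth_vf A p Y \<longrightarrow>
        D p x (\<lambda>q. \<phi> q (Y q)) - \<phi> p (D p x Y) =
          (f1 p - f3 p) *\<^sub>R (g p x (Y p) *\<^sub>R \<xi> p - \<eta> p (Y p) *\<^sub>R x)) \<and>
     (\<forall>p x. D p x \<xi> = - ((f1 p - f3 p) *\<^sub>R \<phi> p x))"

section \<open>Submanifolds\<close>

text \<open>A submanifold is a manifold with atlas B together with an immersion \<open>\<iota>\<close> into the ambient
  manifold with atlas A.\<close>

definition differential ::
  "('k, 'b::euclidean_space) chart set \<Rightarrow> ('m, 'a::euclidean_space) chart set \<Rightarrow> ('k \<Rightarrow> 'm) \<Rightarrow>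
   'k \<Rightarrow> 'b \<Rightarrow> 'a"
where
  "differential B A \<iota> p x = tderiv B p x (coord A (\<iota> p) \<circ> \<iota>)"

definition immersion ::
  "('k::topological_space, 'b::euclidean_space) chart set \<Rightarrow>
   ('m::topological_space, 'a::euclidean_space) chart set \<Rightarrow> ('k \<Rightarrow> 'm) \<Rightarrow> bool"
where
  "immersion B A \<iota> \<longleftrightarrow>
     continuous_on UNIV \<iota> \<and>
     (\<forall>p. smooth_near B p (coord A (\<iota> p) \<circ> \<iota>)) \<and>
     (\<forall>p. inj (differential B A \<iota> p))"

definition induced_metric ::
  "('k, 'b::euclidean_space) chart set \<Rightarrow> ('m, 'a::euclidean_space) chart set \<Rightarrow> ('k \<Rightarrow> 'm) \<Rightarrow>
   ('m \<Rightarrow> 'a \<Rightarrow> 'a \<Rightarrow> real) \<Rightarrow> 'k \<Rightarrow> 'b \<Rightarrow> 'b \<Rightarrow> real"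
where
  "induced_metric B A \<iota> g p x y = g (\<iota> p) (differential B A \<iota> p x) (differential B A \<iota> p y)"

definition invariant_submanifold ::
  "('k, 'b::euclidean_space) chart set \<Rightarrow> ('m, 'a::euclidean_space) chart set \<Rightarrow> ('k \<Rightarrow> 'm) \<Rightarrow>
   ('m \<Rightarrow> 'a \<Rightarrow> 'a) \<Rightarrow> ('m \<Rightarrow> 'a) \<Rightarrow> bool"
where
  "invariant_submanifold B A \<iota> \<phi> \<xi> \<longleftrightarrow>
     (\<forall>p. \<xi> (\<iota> p) \<in> range (differential B A \<iota> p) \<and>
          \<phi> (\<iota> p) ` range (differential B A \<iota> p) \<subseteq> range (differential B A \<iota> p))"

text \<open>Covariant derivative, with respect to the ambient connection D, of a vector field V along
  \<open>\<iota>\<close> (so V q is a tangent vector of the ambient manifold at \<open>\<iota> q\<close>). In the coordinate fields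
  \<open>E\<^sub>i\<close> of the chart at \<open>\<iota> p\<close>, \<open>V = (\<Sum>i. V\<^sup>i (E\<^sub>i \<circ> \<iota>))\<close> and the derivative at p along x is
  \<open>\<Sum>i. d V\<^sup>i(x) E\<^sub>i + V\<^sup>i D\<^bsub>d\<iota>(x)\<^esub> E\<^sub>i\<close>.\<close>

definition pullback_connection ::
  "('k, 'b::euclidean_space) chart set \<Rightarrow> ('m, 'a::euclidean_space) chart set \<Rightarrow> ('k \<Rightarrow> 'm) \<Rightarrow>
   ('m \<Rightarrow> 'a \<Rightarrow> ('m \<Rightarrow> 'a) \<Rightarrow> 'a) \<Rightarrow> 'k \<Rightarrow> 'b \<Rightarrow> ('k \<Rightarrow> 'a) \<Rightarrow> 'a"
where
  "pullback_connection B A \<iota> D p x V =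
     tderiv B p x (\<lambda>q. components A (\<iota> p) (\<iota> q) (V q))
   + (\<Sum>i\<in>Basis. (V p \<bullet> i) *\<^sub>R D (\<iota> p) (differential B A \<iota> p x) (coord_field A (\<iota> p) i))"

text \<open>The second fundamental form at p. It is tensorial, so the tangent vector y may be extended to
  any field near p; here it is extended with constant components.\<close>

definition second_fundamental_form ::
  "('k, 'b::euclidean_space) chart set \<Rightarrow> ('m, 'a::euclidean_space) chart set \<Rightarrow> ('k \<Rightarrow> 'm) \<Rightarrow>
   ('m \<Rightarrow> 'a \<Rightarrow> ('m \<Rightarrow> 'a) \<Rightarrow> 'a) \<Rightarrow> ('k \<Rightarrow> 'b \<Rightarrow> ('k \<Rightarrow> 'b) \<Rightarrow> 'b) \<Rightarrow> 'k \<Rightarrow> 'b \<Rightarrow> 'b \<Rightarrow> 'a"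
where
  "second_fundamental_form B A \<iota> D DM p x y =
     (let Y = coord_field B p y
      in pullback_connection B A \<iota> D p x (\<lambda>q. differential B A \<iota> q (Y q))
         - differential B A \<iota> p (DM p x Y))"

definition totally_geodesic ::
  "('k, 'b::euclidean_space) chart set \<Rightarrow> ('m, 'a::euclidean_space) chart set \<Rightarrow> ('k \<Rightarrow> 'm) \<Rightarrow>
   ('m \<Rightarrow> 'a \<Rightarrow> ('m \<Rightarrow> 'a) \<Rightarrow> 'a) \<Rightarrow> ('k \<Rightarrow> 'b \<Rightarrow> ('k \<Rightarrow> 'b) \<Rightarrow> 'b) \<Rightarrow> bool"
where
  "totally_geodesic B A \<iota> D DM \<longleftrightarrow> (\<forall>p x y. second_fundamental_form B A \<iota> D DM p x y = 0)"

definition normal_part ::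
  "('k, 'b::euclidean_space) chart set \<Rightarrow> ('m, 'a::euclidean_space) chart set \<Rightarrow> ('k \<Rightarrow> 'm) \<Rightarrow>
   ('m \<Rightarrow> 'a \<Rightarrow> 'a \<Rightarrow> real) \<Rightarrow> 'k \<Rightarrow> 'a \<Rightarrow> 'a"
where
  "normal_part B A \<iota> g p v =
     (THE w. (\<forall>x. g (\<iota> p) w (differential B A \<iota> p x) = 0) \<and> v - w \<in> range (differential B A \<iota> p))"

definition normal_connection ::
  "('k, 'b::euclidean_space) chart set \<Rightarrow> ('m, 'a::euclidean_space) chart set \<Rightarrow> ('k \<Rightarrow> 'm) \<Rightarrow>
   ('m \<Rightarrow> 'a \<Rightarrow> 'a \<Rightarrow> real) \<Rightarrow> ('m \<Rightarrow> 'a \<Rightarrow> ('m \<Rightarrow> 'a) \<Rightarrow> 'a) \<Rightarrow> 'k \<Rightarrow> 'b \<Rightarrow> ('k \<Rightarrow> 'a) \<Rightarrow> 'a"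
where
  "normal_connection B A \<iota> g D p x V = normal_part B A \<iota> g p (pullback_connection B A \<iota> D p x V)"

text \<open>As in the source, n is the n of the ambient dimension 2n + 1, also in the coefficient of the
  concircular curvature tensor of the submanifold.\<close>

definition concircular_curvature ::
  "nat \<Rightarrow> ('k, 'b::euclidean_space) chart set \<Rightarrow> ('k \<Rightarrow> 'b \<Rightarrow> 'b \<Rightarrow> real) \<Rightarrow>
   ('k \<Rightarrow> 'b \<Rightarrow> ('k \<Rightarrow> 'b) \<Rightarrow> 'b) \<Rightarrow> ('k \<Rightarrow> 'b) \<Rightarrow> ('k \<Rightarrow> 'b) \<Rightarrow> ('k \<Rightarrow> 'b) \<Rightarrow> 'k \<Rightarrow> 'b"
where
  "concircular_curvature n B gM DM X Y Z p =
     curvature B DM X Y Z p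
   - (scalar_curvature B gM DM p / (2 * real n * (2 * real n + 1))) *\<^sub>R
       (gM p (Y p) (Z p) *\<^sub>R X p - gM p (X p) (Z p) *\<^sub>R Y p)"

definition concircularly_semiparallel ::
  "nat \<Rightarrow> ('k::topological_space, 'b::euclidean_space) chart set \<Rightarrow>
   ('m, 'a::euclidean_space) chart set \<Rightarrow> ('k \<Rightarrow> 'm) \<Rightarrow> ('m \<Rightarrow> 'a \<Rightarrow> 'a \<Rightarrow> real) \<Rightarrow>
   ('m \<Rightarrow> 'a \<Rightarrow> ('m \<Rightarrow> 'a) \<Rightarrow> 'a) \<Rightarrow> ('k \<Rightarrow> 'b \<Rightarrow> ('k \<Rightarrow> 'b) \<Rightarrow> 'b) \<Rightarrow> bool"
where
  "concircularly_semiparallel n B A \<iota> g D DM \<longleftrightarrow>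
     (let h = second_fundamental_form B A \<iota> D DM;
          C = concircular_curvature n B (induced_metric B A \<iota> g) DM
      in \<forall>p X Y Z U. smooth_vf B p X \<longrightarrow> smooth_vf B p Y \<longrightarrow> smooth_vf B p Z \<longrightarrow> smooth_vf B p U \<longrightarrow>
           curvature B (normal_connection B A \<iota> g D) X Y (\<lambda>q. h q (Z q) (U q)) p
         - h p (C X Y Z p) (U p) - h p (Z p) (C X Y U p) = 0)"

end

theory Submission
  imports Defs
begin

text \<open>Write \<open>f = f1 - f3\<close>. Computing \<open>R(X,\<xi>)\<xi>\<close> of the ambient manifold once from the structure
  equations and once from the curvature formula gives \<open>f\<^sup>2 = f\<close>, hence \<open>f = 1\<close> along the submanifold.
  Since \<open>D\<^sub>X \<xi> = - f \<phi>X\<close> is tangent and the second fundamental form h is normal, \<open>h(X,\<xi>) = 0\<close>, and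
  \<open>R(X,\<xi>)\<xi> = X - \<eta>(X)\<xi>\<close> holds on the submanifold as well; this last step uses only that the
  pullback of the ambient connection commutes with \<open>\<phi>\<close> in the direction \<open>\<xi>\<close>, not the Gauss equation.
  Evaluating semiparallelity on \<open>X, \<xi>, Z, \<xi>\<close> leaves
  \<open>h(Z, C(X,\<xi>)\<xi>) = (1 - r/(2n(2n+1))) h(Z,X) = 0\<close>.\<close>

section \<open>Calculus of smooth functions at a point\<close>

text \<open>The last argument \<xi> removes R^perp: the section h(Z,\<xi>) is identically zero, so
  the normal connection is only ever applied to the zero section. The work lies elsewhere. Before
  curvature or semiparallelity can be evaluated on \<xi>, it must be a smooth field on the
  submanifold, and there it is known only as the solution of d\<iota>(\<xi>M) = \<xi>, a linear
  system with an injective, in general non-square matrix. Smoothness of the solution is proved by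
  differentiating the system, which replaces adapted slice charts. Normality of h rests on its
  symmetry, which is read off in coordinates: h(x,y) is made of the second derivative of the
  coordinate expression of \<iota> and two Christoffel terms, each symmetric; hence the need for
  Schwarz's theorem. The condition on r says exactly that the factor 1 - r/(2n(2n+1)) is nonzero
  once f = 1. In the other direction, h = 0 makes all three terms of semiparallelity vanish.\<close>

lemma Ck_on_SucD:
  "Ck_on (Suc k) S f \<Longrightarrow> x \<in> S \<Longrightarrow> (f has_derivative frechet_derivative f (at x)) (at x)"
  by (auto simp: frechet_derivative_works[symmetric])

text \<open>A derivative at x also sees values off S, so it is openness that makes the values on S
  decisive. \<open>frechet_derivative\<close> is a choice; uniqueness of derivatives identifies the
  two choices.\<close>

lemma Ck_on_cong:
  assumes "open S" and "\<And>x. x \<in> S \<Longrightarrow> f x = g x" and "Ck_on k S f"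
  shows "Ck_on k S g"
  using assms(2,3)
proof (induction k arbitrary: f g)
  case 0
  then show ?case by (simp cong: continuous_on_cong)
next
  case (Suc k)
  have D: "(g has_derivative frechet_derivative f (at x)) (at x)" if "x \<in> S" for x
    using has_derivative_transform_within_open[OF Ck_on_SucD[OF Suc.prems(2) that] assms(1) that
      Suc.prems(1)] .
  then have eq: "frechet_derivative f (at x) = frechet_derivative g (at x)" if "x \<in> S" for x
    using frechet_derivative_at that by blast
  have "Ck_on k S (\<lambda>x. frechet_derivative g (at x) v)" for v
    by (rule Suc.IH[of "\<lambda>x. frechet_derivative f (at x) v"]) (use Suc.prems eq in auto)
  with D show ?case by (auto simp: differentiable_def)
qed

text \<open>Lets the inductions below use derivatives given by the product and chain rules instead
  of the chosen \<open>frechet_derivative\<close>.\<close>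

lemma Ck_on_SucI:
  assumes "open S" and "\<And>x. x \<in> S \<Longrightarrow> (f has_derivative f' x) (at x)"
    and "\<And>v. Ck_on k S (\<lambda>x. f' x v)"
  shows "Ck_on (Suc k) S f"
proof -
  have "f' x = frechet_derivative f (at x)" if "x \<in> S" for x
    using frechet_derivative_at[OF assms(2)[OF that]] .
  then show ?thesis
    using assms(2) Ck_on_cong[OF assms(1) _ assms(3)] by (auto simp: differentiable_def)
qed

lemma Ck_on_subset: "T \<subseteq> S \<Longrightarrow> Ck_on k S f \<Longrightarrow> Ck_on k T f"
  by (induction k arbitrary: f) (auto intro: continuous_on_subset)

lemma Ck_on_lower: "Ck_on (Suc k) S f \<Longrightarrow> Ck_on k S f"
proof (induction k arbitrary: f)
  case 0
  then show ?case
    by (auto intro!: differentiable_imp_continuous_on differentiable_at_imp_differentiable_on)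
qed auto

lemma Ck_on_const: "Ck_on k S (\<lambda>x. c)"
  by (induction k arbitrary: c) auto

lemma Ck_on_add:
  assumes "open S" "Ck_on k S f" "Ck_on k S g"
  shows "Ck_on k S (\<lambda>x. f x + g x)"
  using assms(2,3)
proof (induction k arbitrary: f g)
  case 0
  then show ?case by (simp add: continuous_on_add)
next
  case (Suc k)
  show ?case
    by (rule Ck_on_SucI[OF assms(1) has_derivative_add[OF Ck_on_SucD Ck_on_SucD]])
      (use Suc in auto)
qed

lemma Ck_on_sum:
  assumes "open S" "\<And>i. i \<in> I \<Longrightarrow> Ck_on k S (f i)"
  shows "Ck_on k S (\<lambda>x. \<Sum>i\<in>I. f i x)"
  using assms(2) by (induction I rule: infinite_finite_induct)
    (auto intro: Ck_on_const Ck_on_add assms(1))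

lemma Ck_on_bounded_bilinear:
  assumes "bounded_bilinear B" "open S" "Ck_on k S f" "Ck_on k S g"
  shows "Ck_on k S (\<lambda>x. B (f x) (g x))"
  using assms(3,4)
proof (induction k arbitrary: f g)
  case 0
  then show ?case by (simp add: bounded_bilinear.continuous_on[OF assms(1)])
next
  case (Suc k)
  have D: "((\<lambda>x. B (f x) (g x)) has_derivative (\<lambda>v. B (f x) (frechet_derivative g (at x) v)
      + B (frechet_derivative f (at x) v) (g x))) (at x)" if "x \<in> S" for x
    using Suc.prems that by (intro bounded_bilinear.FDERIV[OF assms(1)] Ck_on_SucD)
  have "Ck_on k S (\<lambda>x. B (f x) (frechet_derivative g (at x) v)
      + B (frechet_derivative f (at x) v) (g x))" for v
    using Suc.prems by (intro Ck_on_add assms(2) Suc.IH)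
      (auto intro: Ck_on_lower simp del: Ck_on.simps(1))
  from Ck_on_SucI[OF assms(2) D this] show ?case by blast
qed

lemma Ck_on_bounded_linear:
  assumes "bounded_linear L" "open S" "Ck_on k S f"
  shows "Ck_on k S (\<lambda>x. L (f x))"
  using assms(3)
proof (induction k arbitrary: f)
  case 0
  then show ?case by (simp add: bounded_linear.continuous_on[OF assms(1)])
next
  case (Suc k)
  show ?case
    by (rule Ck_on_SucI[OF assms(2) bounded_linear.has_derivative[OF assms(1) Ck_on_SucD]])
      (use Suc assms(2) in auto)
qed

lemma linear_basis_sum:
  fixes v :: "'a::euclidean_space"
  assumes "linear L" shows "L v = (\<Sum>i\<in>Basis. (v \<bullet> i) *\<^sub>R L i)"
proof -
  have "L v = L (\<Sum>i\<in>Basis. (v \<bullet> i) *\<^sub>R i)" by (simp add: euclidean_representation)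
  also have "\<dots> = (\<Sum>i\<in>Basis. (v \<bullet> i) *\<^sub>R L i)"
    using assms by (simp add: linear_sum linear_cmul)
  finally show ?thesis .
qed

text \<open>\<open>Ck_on\<close> differentiates in fixed directions and so controls a family of
  linear maps only through its values on fixed vectors. Expanding V in a basis turns the application
  into a finite sum of products.\<close>

lemma Ck_on_linear_apply:
  fixes V :: "'e::real_normed_vector \<Rightarrow> 'b::euclidean_space"
  assumes "open S" "\<And>x. x \<in> S \<Longrightarrow> linear (M x)" "\<And>v. Ck_on k S (\<lambda>x. M x v)" "Ck_on k S V"
  shows "Ck_on k S (\<lambda>x. M x (V x))"
proof (rule Ck_on_cong[OF assms(1)])
  show "Ck_on k S (\<lambda>x. \<Sum>i\<in>Basis. (V x \<bullet> i) *\<^sub>R M x i)"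
    using assms by (intro Ck_on_sum Ck_on_bounded_bilinear[OF bounded_bilinear_scaleR]
        Ck_on_bounded_linear[OF bounded_linear_inner_left]) auto
qed (use linear_basis_sum[OF assms(2)] in simp)

text \<open>The chain rule is a linear map, depending on \<open>f x\<close>, applied to a derivative
  of f. \<open>Ck_on_linear_apply\<close> handles this, which is why f takes values in a Euclidean
  space.\<close>

lemma Ck_on_compose:
  fixes f :: "'e::real_normed_vector \<Rightarrow> 'f::euclidean_space"
  assumes "open S" "Ck_on k S f" "Ck_on k T g" "f ` S \<subseteq> T"
  shows "Ck_on k S (\<lambda>x. g (f x))"
  using assms(2,3)
proof (induction k arbitrary: g)
  case 0
  then show ?case using continuous_on_compose2[OF _ _ assms(4)] by simp
next
  case (Suc k)
  have D: "((\<lambda>x. g (f x)) has_derivative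
      (\<lambda>v. frechet_derivative g (at (f x)) (frechet_derivative f (at x) v))) (at x)" if "x \<in> S" for x
    using Suc.prems that assms(4)
    by (intro has_derivative_compose[where g = g and f = f] Ck_on_SucD[where S = T] Ck_on_SucD) auto
  have "Ck_on k S (\<lambda>x. frechet_derivative g (at (f x)) (frechet_derivative f (at x) v))" for v
  proof (rule Ck_on_linear_apply[OF assms(1)])
    show "linear (frechet_derivative g (at (f x)))" if "x \<in> S" for x
      using Suc.prems(2) assms(4) that by (intro linear_frechet_derivative) auto
    show "Ck_on k S (\<lambda>x. frechet_derivative g (at (f x)) v)" for v
      using Suc.IH[of "\<lambda>y. frechet_derivative g (at y) v"] Suc.prems(2) Ck_on_lower[OF Suc.prems(1)]
      by simp
    show "Ck_on k S (\<lambda>x. frechet_derivative f (at x) v)"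
      using Suc.prems(1) by simp
  qed
  from Ck_on_SucI[OF assms(1) D this] show ?case by blast
qed

section \<open>Smooth solutions of linear systems with injective matrix\<close>

text \<open>A product rule with one factor merely continuous: G is O(|y - a|) and u tends to 0, so
  the product is o(|y - a|). It serves a factor whose differentiability is still to be
  proved.\<close>

lemma has_derivative_zero_scaleR:
  fixes u :: "'e::real_normed_vector \<Rightarrow> real"
  assumes "isCont u a" "u a = 0" "(G has_derivative G') (at a)" "G a = 0"
  shows "((\<lambda>x. u x *\<^sub>R G x) has_derivative (\<lambda>_. 0)) (at a)"
proof -
  obtain K where K: "\<And>v. norm (G' v) \<le> norm v * K"
    using bounded_linear.pos_bounded[OF has_derivative_bounded_linear[OF assms(3)]] by blast
  have u: "(u \<longlongrightarrow> 0) (at a)" using assms(1,2) by (simp add: isCont_def)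
  have G: "((\<lambda>y. norm (G y - G' (y - a)) / norm (y - a)) \<longlongrightarrow> 0) (at a)"
    using assms(3,4) by (simp add: has_derivative_iff_norm)
  have "((\<lambda>y. \<bar>u y\<bar> * (norm (G y - G' (y - a)) / norm (y - a) + K)) \<longlongrightarrow> 0) (at a)"
    using tendsto_mult[OF tendsto_rabs_zero[OF u] tendsto_add[OF G tendsto_const[of K]]] by simp
  then have "((\<lambda>y. norm (u y *\<^sub>R G y) / norm (y - a)) \<longlongrightarrow> 0) (at a)"
  proof (rule Lim_null_comparison[rotated])
    have "norm (u y *\<^sub>R G y) / norm (y - a) \<le> \<bar>u y\<bar> * (norm (G y - G' (y - a)) / norm (y - a) + K)"
      if "y \<noteq> a" for y
    proof -
      have "norm (G y) \<le> norm (G y - G' (y - a)) + norm (G' (y - a))" by norm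
      also have "\<dots> \<le> norm (G y - G' (y - a)) + norm (y - a) * K" using K by simp
      finally have "norm (G y) / norm (y - a) \<le> norm (G y - G' (y - a)) / norm (y - a) + K"
        using that by (simp add: field_simps)
      then show ?thesis using mult_left_mono[of _ _ "\<bar>u y\<bar>"] by fastforce
    qed
    then show "\<forall>\<^sub>F y in at a. norm (norm (u y *\<^sub>R G y) / norm (y - a))
        \<le> \<bar>u y\<bar> * (norm (G y - G' (y - a)) / norm (y - a) + K)"
      by (auto simp: eventually_at_filter)
  qed
  then show ?thesis
    using assms(2,4) by (simp add: has_derivative_iff_norm)
qed

text \<open>An injective \<open>M a\<close> is bounded below by some K, and for nearby
  \<open>M x\<close> the bound survives up to the error \<open>E x\<close>. Hence
  \<open>w x - w a\<close> is controlled by the residual of the fixed vector \<open>w a\<close>,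
  which tends to 0.\<close>

lemma linear_system_isCont:
  fixes w :: "'e::real_normed_vector \<Rightarrow> 'b::euclidean_space" and M :: "'e \<Rightarrow> 'b \<Rightarrow> 'a::euclidean_space"
  assumes "open S" "a \<in> S" "\<And>x. x \<in> S \<Longrightarrow> linear (M x)" "inj (M a)"
    and "\<And>v. isCont (\<lambda>x. M x v) a" "isCont c a" "\<And>x. x \<in> S \<Longrightarrow> M x (w x) = c x"
  shows "isCont w a"
proof -
  obtain K where K: "K > 0" "\<And>v. K * norm v \<le> norm (M a v)"
    using linear_inj_bounded_below_pos[OF assms(3)[OF assms(2)] assms(4)] by (metis mult.commute)
  \<comment> \<open>The sum over a basis dominates the operator norm of \<open>M x - M a\<close>, so
    continuity on single vectors is enough to make it small.\<close>
  define E where "E x = (\<Sum>i\<in>Basis. norm (M x i - M a i))" for x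
  have E: "(E \<longlongrightarrow> 0) (at a)"
    unfolding E_def using assms(5)
    by (intro tendsto_null_sum tendsto_norm_zero LIM_zero) (simp add: isCont_def)
  have bd: "(K - E x) * norm (w x - w a) \<le> norm (c x - M x (w a))" if "x \<in> S" for x
  proof -
    let ?d = "w x - w a"
    note lx = assms(3)[OF that] and la = assms(3)[OF assms(2)]
    have "M a ?d = M x ?d - (\<Sum>i\<in>Basis. (?d \<bullet> i) *\<^sub>R (M x i - M a i))"
      using linear_basis_sum[OF la, of ?d] linear_basis_sum[OF lx, of ?d]
      by (simp add: scaleR_diff_right sum_subtractf)
    also have "M x ?d = c x - M x (w a)"
      using assms(7)[OF that] by (simp add: linear_diff[OF lx])
    finally have "norm (M a ?d) \<le> norm (c x - M x (w a)) + norm (\<Sum>i\<in>Basis. (?d \<bullet> i) *\<^sub>R (M x i - M a i))"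
      using norm_triangle_ineq4 by metis
    also have "norm (\<Sum>i\<in>Basis. (?d \<bullet> i) *\<^sub>R (M x i - M a i)) \<le> (\<Sum>i\<in>Basis. norm ?d * norm (M x i - M a i))"
      by (intro order_trans[OF norm_sum] sum_mono) (auto intro!: mult_right_mono Basis_le_norm)
    finally show ?thesis using K(2)[of ?d] by (simp add: E_def sum_distrib_left algebra_simps)
  qed
  have lim: "((\<lambda>x. norm (c x - M x (w a)) / (K - E x)) \<longlongrightarrow> norm (c a - M a (w a)) / (K - 0)) (at a)"
    using assms(5,6) E K(1) by (intro tendsto_intros) (auto simp: isCont_def)
  have "\<forall>\<^sub>F x in at a. E x < K" using order_tendstoD(2)[OF E K(1)] .
  moreover have "\<forall>\<^sub>F x in at a. x \<in> S" using assms(1,2) by (simp add: eventually_at_in_open')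
  ultimately have "\<forall>\<^sub>F x in at a. norm (w x - w a) \<le> norm (c x - M x (w a)) / (K - E x)"
  proof eventually_elim
    case (elim x)
    then show ?case using bd[of x] by (simp add: pos_le_divide_eq mult.commute)
  qed
  then have "((\<lambda>x. w x - w a) \<longlongrightarrow> 0) (at a)"
    using lim assms(7)[OF assms(2)] by (intro Lim_null_comparison[of "\<lambda>x. w x - w a"]) auto
  then show ?thesis by (simp add: isCont_def LIM_zero_iff)
qed

text \<open>Around a the system reads
  \<open>M a (w x - w a) = c x - M x (w a) - (M x - M a) (w x - w a)\<close>. The last term,
  \<open>?G\<close> in basis coordinates, is a product of two vanishing factors and has derivative 0
  once w is continuous; a left inverse of \<open>M a\<close> then isolates w.\<close>

lemma linear_system_differentiable:
  fixes w :: "'e::real_normed_vector \<Rightarrow> 'b::euclidean_space" and M :: "'e \<Rightarrow> 'b \<Rightarrow> 'a::euclidean_space"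
  assumes "open S" "a \<in> S" "\<And>x. x \<in> S \<Longrightarrow> linear (M x)" "inj (M a)"
    and "\<And>v. (\<lambda>x. M x v) differentiable (at a)" "c differentiable (at a)"
    and "\<And>x. x \<in> S \<Longrightarrow> M x (w x) = c x"
  shows "w differentiable (at a)"
proof -
  note la = assms(3)[OF assms(2)]
  have cont: "isCont w a"
    using assms by (intro linear_system_isCont[where M = M and c = c])
      (auto intro: differentiable_imp_continuous_within)
  obtain N where N: "linear N" "N \<circ> M a = id" 
    using linear_injective_left_inverse[OF la assms(4)] by blast
  let ?G = "\<lambda>x. \<Sum>i\<in>Basis. ((w x - w a) \<bullet> i) *\<^sub>R (M x i - M a i)"
  have "((\<lambda>x. ((w x - w a) \<bullet> i) *\<^sub>R (M x i - M a i)) has_derivative (\<lambda>_. 0)) (at a)" for i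
  proof -
    obtain G' where "((\<lambda>x. M x i) has_derivative G') (at a)"
      using assms(5) unfolding differentiable_def by blast
    then have "((\<lambda>x. M x i - M a i) has_derivative G') (at a)"
      by (auto intro!: derivative_eq_intros)
    then show ?thesis
      by (intro has_derivative_zero_scaleR) (use cont in \<open>auto intro!: continuous_intros\<close>)
  qed
  then have "(?G has_derivative (\<lambda>_. \<Sum>i\<in>(Basis::'b set). 0)) (at a)"
    by (intro has_derivative_sum)
  then have "?G differentiable (at a)"
    unfolding differentiable_def by blast
  then have "(\<lambda>x. c x - M x (w a) - ?G x) differentiable (at a)"
    using assms(5,6) by (intro differentiable_diff) auto
  then obtain F' where "((\<lambda>x. c x - M x (w a) - ?G x) has_derivative F') (at a)"
    unfolding differentiable_def by blast
  then have "((\<lambda>x. N (c x - M x (w a) - ?G x) + w a) has_derivative (\<lambda>v. N (F' v) + 0)) (at a)"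
    using N(1) has_derivative_add[OF bounded_linear.has_derivative has_derivative_const]
    unfolding linear_conv_bounded_linear by blast
  moreover have "w x = N (c x - M x (w a) - ?G x) + w a" if "x \<in> S" for x
  proof -
    let ?d = "w x - w a"
    note lx = assms(3)[OF that]
    have "M a ?d = M x ?d - ?G x"
      using linear_basis_sum[OF la, of ?d] linear_basis_sum[OF lx, of ?d]
      by (simp add: scaleR_diff_right sum_subtractf)
    also have "M x ?d = c x - M x (w a)"
      using assms(7)[OF that] by (simp add: linear_diff[OF lx])
    finally have "N (M a ?d) = N (c x - M x (w a) - ?G x)" by simp
    moreover have "N (M a ?d) = ?d" using N(2) by (metis comp_apply id_apply)
    ultimately show ?thesis by simp
  qed
  then have "N (c x - M x (w a) - ?G x) + w a = w x" if "x \<in> S" for x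
    using that by simp
  ultimately have "(w has_derivative (\<lambda>v. N (F' v) + 0)) (at a)"
    by (rule has_derivative_transform_within_open[OF _ assms(1,2)])
  then show ?thesis
    unfolding differentiable_def by blast
qed

text \<open>Differentiating \<open>M w = c\<close> gives a system for the derivative of w with the same matrix M.\<close>

lemma Ck_on_linear_system:
  fixes w :: "'e::real_normed_vector \<Rightarrow> 'b::euclidean_space" and M :: "'e \<Rightarrow> 'b \<Rightarrow> 'a::euclidean_space"
  assumes "open S" and lin: "\<And>x. x \<in> S \<Longrightarrow> linear (M x)" and inj: "\<And>x. x \<in> S \<Longrightarrow> inj (M x)"
    and "\<And>v. Ck_on k S (\<lambda>x. M x v)" "Ck_on k S c" "\<And>x. x \<in> S \<Longrightarrow> M x (w x) = c x"
  shows "Ck_on k S w"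
  using assms(4-6)
proof (induction k arbitrary: w c)
  case 0
  then show ?case
    using assms(1) lin inj
    by (auto simp: continuous_on_eq_continuous_at intro!:
      linear_system_isCont[where M = M and c = c])
next
  case (Suc k)
  let ?M = "\<lambda>x v u. frechet_derivative (\<lambda>x. M x u) (at x) v"
  let ?w = "\<lambda>x. frechet_derivative w (at x)" and ?c = "\<lambda>x. frechet_derivative c (at x)"
  have diff: "w differentiable (at x)" if "x \<in> S" for x
    using Suc.prems that assms(1) lin inj
    by (intro linear_system_differentiable[where M = M and c = c and S = S]) auto
  then have D: "(w has_derivative ?w x) (at x)" if "x \<in> S" for x
    using that frechet_derivative_works by blast
  have eq: "M x (?w x v) = ?c x v - (\<Sum>i\<in>Basis. (w x \<bullet> i) *\<^sub>R ?M x v i)" if "x \<in> S" for x v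
  proof -
    have "((\<lambda>y. \<Sum>i\<in>Basis. (w y \<bullet> i) *\<^sub>R M y i) has_derivative
        (\<lambda>v. \<Sum>i\<in>Basis. (w x \<bullet> i) *\<^sub>R ?M x v i + (?w x v \<bullet> i) *\<^sub>R M x i)) (at x)"
      by (intro has_derivative_sum has_derivative_scaleR has_derivative_inner_left D[OF that]
          Ck_on_SucD[OF Suc.prems(1) that])
    moreover have "(\<Sum>i\<in>Basis. (w y \<bullet> i) *\<^sub>R M y i) = c y" if "y \<in> S" for y
      using linear_basis_sum[OF lin[OF that], of "w y"] Suc.prems(3)[OF that] by simp
    ultimately have "(c has_derivative
        (\<lambda>v. \<Sum>i\<in>Basis. (w x \<bullet> i) *\<^sub>R ?M x v i + (?w x v \<bullet> i) *\<^sub>R M x i)) (at x)"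
      using has_derivative_transform_within_open[OF _ assms(1) that] by blast
    from frechet_derivative_at[OF this]
    have "?c x v = (\<Sum>i\<in>Basis. (w x \<bullet> i) *\<^sub>R ?M x v i) + (\<Sum>i\<in>Basis. (?w x v \<bullet> i) *\<^sub>R M x i)"
      by (simp add: fun_eq_iff sum.distrib)
    then show ?thesis
      using linear_basis_sum[OF lin[OF that], of "?w x v"] by simp
  qed
  \<comment> \<open>The induction hypothesis is used twice: here for w itself, because w occurs on
    the right-hand side of the differentiated system, and below for the derivative of w.\<close>
  have "Ck_on k S w"
    by (rule Suc.IH[OF _ _ Suc.prems(3)])
      (use Suc.prems in \<open>auto intro: Ck_on_lower simp del: Ck_on.simps\<close>)
  then have "Ck_on k S (\<lambda>x. - (\<Sum>i\<in>Basis. (w x \<bullet> i) *\<^sub>R ?M x v i))" for v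
    using Suc.prems(1) assms(1)
      by (intro Ck_on_bounded_linear[OF bounded_linear_minus[OF bounded_linear_ident]] Ck_on_sum
        Ck_on_bounded_bilinear[OF bounded_bilinear_scaleR]
        Ck_on_bounded_linear[OF bounded_linear_inner_left]) auto
  then have rhs: "Ck_on k S (\<lambda>x. ?c x v + - (\<Sum>i\<in>Basis. (w x \<bullet> i) *\<^sub>R ?M x v i))" for v
    using Suc.prems(2) by (intro Ck_on_add assms(1)) auto
  have "Ck_on k S (\<lambda>x. ?w x v)" for v
    by (rule Suc.IH[OF _ rhs]) (use eq Suc.prems in \<open>auto intro: Ck_on_lower simp del: Ck_on.simps\<close>)
  with diff show ?case by simp
qed

section \<open>Symmetry of second derivatives\<close>

text \<open>Mean value theorem twice, once in each direction: the second difference over the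
  parallelogram with sides h u and h v is h squared times a mixed derivative at one of its
  points.\<close>

lemma mixed_difference_mvt:
  fixes f :: "'e::real_normed_vector \<Rightarrow> real"
  assumes "0 < h" and S: "\<And>s t. 0 \<le> s \<Longrightarrow> s \<le> h \<Longrightarrow> 0 \<le> t \<Longrightarrow> t \<le> h \<Longrightarrow> x + s *\<^sub>R u + t *\<^sub>R v \<in> S"
    and f: "\<And>y. y \<in> S \<Longrightarrow> (f has_derivative f' y) (at y)"
    and f': "\<And>y. y \<in> S \<Longrightarrow> ((\<lambda>y. f' y u) has_derivative f'' y) (at y)"
  shows "\<exists>s t. 0 \<le> s \<and> s \<le> h \<and> 0 \<le> t \<and> t \<le> h \<and>
    f (x + h *\<^sub>R u + h *\<^sub>R v) - f (x + h *\<^sub>R u) - f (x + h *\<^sub>R v) + f x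
      = h * h * f'' (x + s *\<^sub>R u + t *\<^sub>R v) v"
proof -
  have D: "((\<lambda>s. f (x + s *\<^sub>R u + t *\<^sub>R v)) has_real_derivative f' (x + s *\<^sub>R u + t *\<^sub>R v) u) (at s)"
    if "0 \<le> s" "s \<le> h" "0 \<le> t" "t \<le> h" for s t
  proof -
    have "((\<lambda>s. f (x + s *\<^sub>R u + t *\<^sub>R v)) has_derivative (\<lambda>a. f' (x + s *\<^sub>R u + t *\<^sub>R v) (a *\<^sub>R u))) (at s)"
      by (rule has_derivative_compose[where g = f and f = "\<lambda>s. x + s *\<^sub>R u + t *\<^sub>R v",
            OF _ f[OF S[OF that]]]) (auto intro!: derivative_eq_intros)
    then show ?thesis
      using linear_scale[OF has_derivative_linear[OF f[OF S[OF that]]]]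
      by (simp add: has_field_derivative_def mult.commute[of _ "f' _ u"])
  qed
  \<comment> \<open>The summand \<open>0 *\<^sub>R v\<close> makes both terms instances of
    \<open>D\<close>.\<close>
  let ?g = "\<lambda>s. f (x + s *\<^sub>R u + h *\<^sub>R v) - f (x + s *\<^sub>R u + 0 *\<^sub>R v)"
  have "\<exists>s>0. s < h \<and> ?g h - ?g 0
      = (h - 0) * (f' (x + s *\<^sub>R u + h *\<^sub>R v) u - f' (x + s *\<^sub>R u + 0 *\<^sub>R v) u)"
    by (intro MVT2 assms(1) DERIV_diff D) (use assms(1) in auto)
  then obtain s where s: "0 < s" "s < h" and 1: "?g h - ?g 0
      = (h - 0) * (f' (x + s *\<^sub>R u + h *\<^sub>R v) u - f' (x + s *\<^sub>R u + 0 *\<^sub>R v) u)" by blast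
  have "((\<lambda>t. f' (x + s *\<^sub>R u + t *\<^sub>R v) u) has_real_derivative f'' (x + s *\<^sub>R u + t *\<^sub>R v) v) (at t)"
    if t: "0 \<le> t" "t \<le> h" for t
  proof -
    have mem: "x + s *\<^sub>R u + t *\<^sub>R v \<in> S" using S s t by simp
    have "((\<lambda>t. f' (x + s *\<^sub>R u + t *\<^sub>R v) u) has_derivative (\<lambda>a. f'' (x + s *\<^sub>R u + t *\<^sub>R v) (a *\<^sub>R v))) (at t)"
      by (rule has_derivative_compose[where g = "\<lambda>y. f' y u" and f = "\<lambda>t. x + s *\<^sub>R u + t *\<^sub>R v",
            OF _ f'[OF mem]]) (auto intro!: derivative_eq_intros)
    then show ?thesis
      using linear_scale[OF has_derivative_linear[OF f'[OF mem]]]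
      by (simp add: has_field_derivative_def mult.commute[of _ "f'' _ v"])
  qed
  from MVT2[OF assms(1) this] obtain t where t: "0 < t" "t < h"
    and 2: "f' (x + s *\<^sub>R u + h *\<^sub>R v) u - f' (x + s *\<^sub>R u + 0 *\<^sub>R v) u = (h - 0) * f'' (x + s *\<^sub>R u + t *\<^sub>R v) v"
    by blast
  show ?thesis
    by (intro exI[of _ s] exI[of _ t]) (use s t 1 2 in \<open>simp add: algebra_simps\<close>)
qed

text \<open>Schwarz's theorem: the second difference is symmetric in u and v, so the two mixed
  derivatives take a common value at points near x, possibly different ones, and continuity at x
  does the rest.\<close>

lemma second_derivative_commute_real:
  fixes f :: "'e::real_normed_vector \<Rightarrow> real"
  assumes "open S" "x \<in> S" and f: "\<And>y. y \<in> S \<Longrightarrow> (f has_derivative f' y) (at y)"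
    and u: "\<And>y. y \<in> S \<Longrightarrow> ((\<lambda>y. f' y u) has_derivative fu y) (at y)"
    and v: "\<And>y. y \<in> S \<Longrightarrow> ((\<lambda>y. f' y v) has_derivative fv y) (at y)"
    and cont: "isCont (\<lambda>y. fu y v) x" "isCont (\<lambda>y. fv y u) x"
  shows "fu x v = fv x u"
proof (rule ccontr)
  assume "fu x v \<noteq> fv x u"
  \<comment> \<open>Half the gap: numbers within e of \<open>fu x v\<close> and of
    \<open>fv x u\<close> cannot be equal.\<close>
  define e where "e = \<bar>fu x v - fv x u\<bar> / 2"
  have e: "e > 0" using \<open>fu x v \<noteq> fv x u\<close> by (simp add: e_def)
  have "\<forall>\<^sub>F y in nhds x. y \<in> S \<and> dist (fu y v) (fu x v) < e \<and> dist (fv y u) (fv x u) < e"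
    using cont e assms(1,2) unfolding isCont_def
    by (intro eventually_conj eventually_nhds_in_open tendstoD[of _ _ "nhds x"])
      (auto simp: tendsto_nhds_iff isCont_def)
  then obtain d where d: "d > 0" "\<And>y. dist y x < d \<Longrightarrow>
      y \<in> S \<and> dist (fu y v) (fu x v) < e \<and> dist (fv y u) (fv x u) < e"
    unfolding eventually_nhds_metric by blast
  \<comment> \<open>Keeps the parallelogram inside the ball of radius d; the summand 1 makes the
    inequality strict and covers u = v = 0.\<close>
  define h where "h = d / (norm u + norm v + 1)"
  have "norm u + norm v + 1 > 0" by (smt (verit) norm_ge_zero)
  then have h: "h > 0" "h * (norm u + norm v) < d"
    using d(1) by (simp_all add: h_def field_simps)
  have near: "dist (x + s *\<^sub>R u + t *\<^sub>R v) x < d"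
    if "0 \<le> s" "s \<le> h" "0 \<le> t" "t \<le> h" for s t
  proof -
    have "dist (x + s *\<^sub>R u + t *\<^sub>R v) x \<le> norm (s *\<^sub>R u) + norm (t *\<^sub>R v)"
      using norm_triangle_ineq[of "s *\<^sub>R u" "t *\<^sub>R v"] by (simp add: dist_norm add.assoc)
    also have "\<dots> \<le> h * (norm u + norm v)"
      using that by (auto simp: distrib_left intro!: add_mono mult_right_mono)
    finally show ?thesis using h(2) by simp
  qed
  have "\<exists>s t. 0 \<le> s \<and> s \<le> h \<and> 0 \<le> t \<and> t \<le> h \<and>
    f (x + h *\<^sub>R u + h *\<^sub>R v) - f (x + h *\<^sub>R u) - f (x + h *\<^sub>R v) + f x
      = h * h * fu (x + s *\<^sub>R u + t *\<^sub>R v) v"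
    by (rule mixed_difference_mvt[OF h(1) _ f u]) (use near d in auto)
  then obtain s t where st: "0 \<le> s" "s \<le> h" "0 \<le> t" "t \<le> h" and
    1: "f (x + h *\<^sub>R u + h *\<^sub>R v) - f (x + h *\<^sub>R u) - f (x + h *\<^sub>R v) + f x
      = h * h * fu (x + s *\<^sub>R u + t *\<^sub>R v) v" by blast
  have "\<exists>s t. 0 \<le> s \<and> s \<le> h \<and> 0 \<le> t \<and> t \<le> h \<and>
    f (x + h *\<^sub>R v + h *\<^sub>R u) - f (x + h *\<^sub>R v) - f (x + h *\<^sub>R u) + f x
      = h * h * fv (x + s *\<^sub>R v + t *\<^sub>R u) u"
  proof (rule mixed_difference_mvt[OF h(1) _ f v])
    show "x + s *\<^sub>R v + t *\<^sub>R u \<in> S" if "0 \<le> s" "s \<le> h" "0 \<le> t" "t \<le> h" for s t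
      using d(2)[OF near[OF that(3,4,1,2)]] by (simp add: add_ac)
  qed
  then obtain t' s' where st': "0 \<le> s'" "s' \<le> h" "0 \<le> t'" "t' \<le> h" and
    2: "f (x + h *\<^sub>R v + h *\<^sub>R u) - f (x + h *\<^sub>R v) - f (x + h *\<^sub>R u) + f x
      = h * h * fv (x + t' *\<^sub>R v + s' *\<^sub>R u) u" by blast
  have "h * h * fu (x + s *\<^sub>R u + t *\<^sub>R v) v = h * h * fv (x + s' *\<^sub>R u + t' *\<^sub>R v) u"
    using 1 2 by (simp add: add_ac) (simp add: algebra_simps)
  then have "fu (x + s *\<^sub>R u + t *\<^sub>R v) v = fv (x + s' *\<^sub>R u + t' *\<^sub>R v) u"
    using h(1) by simp
  moreover have "dist (fu (x + s *\<^sub>R u + t *\<^sub>R v) v) (fu x v) < e"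
    using d(2)[OF near[OF st]] by blast
  moreover have "dist (fv (x + s' *\<^sub>R u + t' *\<^sub>R v) u) (fv x u) < e"
    using d(2)[OF near[OF st']] by blast
  ultimately show False
    by (simp add: e_def dist_real_def) argo
qed

text \<open>The mean value theorem concerns real functions, hence the passage to coordinates of
  f.\<close>

lemma Ck_on_2_commute:
  fixes f :: "'e::real_normed_vector \<Rightarrow> 'f::euclidean_space"
  assumes "open S" "x \<in> S" "Ck_on (Suc (Suc 0)) S f"
  shows "frechet_derivative (\<lambda>y. frechet_derivative f (at y) u) (at x) v
       = frechet_derivative (\<lambda>y. frechet_derivative f (at y) v) (at x) u"
proof (rule euclidean_eqI)
  fix i :: 'f assume "i \<in> Basis"
  let ?D = "\<lambda>v y. frechet_derivative (\<lambda>y. frechet_derivative f (at y) v) (at y)"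
  have 1: "(f has_derivative frechet_derivative f (at y)) (at y)" if "y \<in> S" for y
    using Ck_on_SucD[OF assms(3) that] .
  have 2: "((\<lambda>y. frechet_derivative f (at y) v) has_derivative ?D v y) (at y)" if "y \<in> S" for y v
    using assms(3) that by (intro Ck_on_SucD[of 0 S]) auto
  have 3: "isCont (\<lambda>y. ?D v y w) x" for v w
    using assms by (auto simp: continuous_on_eq_continuous_at)
  show "?D u x v \<bullet> i = ?D v x u \<bullet> i"
    by (rule second_derivative_commute_real[OF assms(1,2) has_derivative_inner_left[OF 1]
          has_derivative_inner_left[OF 2] has_derivative_inner_left[OF 2]])
      (use 3 in \<open>auto intro!: continuous_intros\<close>)
qed

section \<open>Germs of smooth maps\<close>

text \<open>The inverse of a coordinate map is meaningful only on the image of its chart, so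
  smoothness in charts is handled as a property of germs. One neighbourhood serves all orders
  k.\<close>

definition smooth_at :: "('e::real_normed_vector \<Rightarrow> 'f::real_normed_vector) \<Rightarrow> 'e \<Rightarrow> bool" where
  "smooth_at f x \<longleftrightarrow> (\<exists>S. open S \<and> x \<in> S \<and> smooth_on S f)"

lemma smooth_atI: "open S \<Longrightarrow> x \<in> S \<Longrightarrow> (\<And>k. Ck_on k S f) \<Longrightarrow> smooth_at f x"
  by (auto simp: smooth_at_def smooth_on_def)

lemma smooth_atE:
  assumes "smooth_at f x" "open T" "x \<in> T"
  obtains S where "open S" "x \<in> S" "S \<subseteq> T" "\<forall>k. Ck_on k S f"
proof -
  obtain S where "open S" "x \<in> S" "smooth_on S f" using assms(1) unfolding smooth_at_def by blast
  then show ?thesis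
    using that[of "S \<inter> T"] assms(2,3) Ck_on_subset[of "S \<inter> T" S] by (auto simp: smooth_on_def)
qed

lemma smooth_at_cong:
  assumes "\<forall>\<^sub>F y in nhds x. f y = g y" "smooth_at f x"
  shows "smooth_at g x"
proof -
  obtain T where T: "open T" "x \<in> T" "\<And>y. y \<in> T \<Longrightarrow> f y = g y"
    using assms(1) unfolding eventually_nhds by blast
  obtain S where S: "open S" "x \<in> S" "S \<subseteq> T" "\<forall>k. Ck_on k S f"
    by (rule smooth_atE[OF assms(2) T(1,2)])
  have "Ck_on k S g" for k
    by (rule Ck_on_cong[OF S(1) _ S(4)[rule_format]]) (use S(3) T(3) in auto)
  with S(1,2) show ?thesis by (rule smooth_atI)
qed

lemma eventually_smooth_at: "smooth_at f x \<Longrightarrow> \<forall>\<^sub>F y in nhds x. smooth_at f y"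
  unfolding smooth_at_def eventually_nhds by blast

lemma smooth_at_has_derivative:
  assumes "smooth_at f x" shows "(f has_derivative frechet_derivative f (at x)) (at x)"
proof -
  obtain S where "x \<in> S" "Ck_on (Suc 0) S f"
    using assms unfolding smooth_at_def smooth_on_def by blast
  then show ?thesis using Ck_on_SucD by blast
qed

lemma smooth_at_differentiable: "smooth_at f x \<Longrightarrow> f differentiable (at x)"
  using smooth_at_has_derivative differentiable_def by blast

lemma smooth_at_linear: "smooth_at f x \<Longrightarrow> linear (frechet_derivative f (at x))"
  by (intro linear_frechet_derivative smooth_at_differentiable)

lemma smooth_at_const: "smooth_at (\<lambda>x. c) x"
  by (rule smooth_atI[of UNIV]) (auto intro: Ck_on_const)

lemma smooth_at_bounded_bilinear:
  assumes "bounded_bilinear B" "smooth_at f x" "smooth_at g x"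
  shows "smooth_at (\<lambda>x. B (f x) (g x)) x"
proof -
  obtain S where S: "open S" "x \<in> S" "\<forall>k. Ck_on k S f"
    by (rule smooth_atE[OF assms(2) open_UNIV UNIV_I])
  obtain T where T: "open T" "x \<in> T" "T \<subseteq> S" "\<forall>k. Ck_on k T g"
    by (rule smooth_atE[OF assms(3) S(1,2)])
  show ?thesis
    using Ck_on_bounded_bilinear[OF assms(1) T(1) Ck_on_subset[OF T(3) S(3)[rule_format]] T(4)[rule_format]]
    by (intro smooth_atI[OF T(1,2)])
qed

lemma smooth_at_add:
  assumes "smooth_at f x" "smooth_at g x"
  shows "smooth_at (\<lambda>x. f x + g x) x"
proof -
  obtain S where S: "open S" "x \<in> S" "\<forall>k. Ck_on k S f"
    by (rule smooth_atE[OF assms(1) open_UNIV UNIV_I])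
  obtain T where T: "open T" "x \<in> T" "T \<subseteq> S" "\<forall>k. Ck_on k T g"
    by (rule smooth_atE[OF assms(2) S(1,2)])
  show ?thesis
    using Ck_on_add[OF T(1) Ck_on_subset[OF T(3) S(3)[rule_format]] T(4)[rule_format]] by (intro
      smooth_atI[OF T(1,2)])
qed

lemma smooth_at_sum:
  "(\<And>i. i \<in> I \<Longrightarrow> smooth_at (f i) x) \<Longrightarrow> smooth_at (\<lambda>x. \<Sum>i\<in>I. f i x) x"
  by (induction I rule: infinite_finite_induct) (auto intro: smooth_at_const smooth_at_add)

lemma smooth_at_bounded_linear:
  "bounded_linear L \<Longrightarrow> smooth_at f x \<Longrightarrow> smooth_at (\<lambda>x. L (f x)) x"
  unfolding smooth_at_def smooth_on_def using Ck_on_bounded_linear by blast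

lemmas smooth_at_scaleR = smooth_at_bounded_bilinear[OF bounded_bilinear_scaleR]
lemmas smooth_at_inner_left = smooth_at_bounded_linear[OF bounded_linear_inner_left]

lemma smooth_at_compose:
  fixes f :: "'e::real_normed_vector \<Rightarrow> 'f::euclidean_space"
  assumes "smooth_at f x" "smooth_at g (f x)"
  shows "smooth_at (\<lambda>x. g (f x)) x"
proof -
  obtain T where T: "open T" "f x \<in> T" "\<forall>k. Ck_on k T g"
    by (rule smooth_atE[OF assms(2) open_UNIV UNIV_I])
  obtain S where S: "open S" "x \<in> S" "\<forall>k. Ck_on k S f"
    by (rule smooth_atE[OF assms(1) open_UNIV UNIV_I])
  have "open (S \<inter> f -` T)"
    using S(1) spec[OF S(3), of 0] T(1) by (intro continuous_open_preimage) auto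
  then have "Ck_on k (S \<inter> f -` T) (\<lambda>x. g (f x))" for k
    by (rule Ck_on_compose[OF _ Ck_on_subset[OF _ S(3)[rule_format]] T(3)[rule_format]]) auto
  with \<open>open (S \<inter> f -` T)\<close> show ?thesis
    using S(2) T(2) by (intro smooth_atI[of "S \<inter> f -` T"]) auto
qed

lemma smooth_at_frechet_derivative:
  assumes "smooth_at f x" shows "smooth_at (\<lambda>y. frechet_derivative f (at y) v) x"
proof -
  obtain S where S: "open S" "x \<in> S" "\<forall>k. Ck_on k S f"
    by (rule smooth_atE[OF assms open_UNIV UNIV_I])
  then have "Ck_on (Suc k) S f" for k by blast
  with S(1,2) show ?thesis by (intro smooth_atI[of S]) auto
qed

lemma smooth_at_linear_apply:
  fixes V :: "'e::real_normed_vector \<Rightarrow> 'b::euclidean_space"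
  assumes "\<forall>\<^sub>F y in nhds x. linear (M y)" "\<And>v. smooth_at (\<lambda>x. M x v) x" "smooth_at V x"
  shows "smooth_at (\<lambda>x. M x (V x)) x"
proof (rule smooth_at_cong)
  show "\<forall>\<^sub>F y in nhds x. (\<Sum>i\<in>Basis. (V y \<bullet> i) *\<^sub>R M y i) = M y (V y)"
    using assms(1) by eventually_elim (simp add: linear_basis_sum[symmetric])
  show "smooth_at (\<lambda>y. \<Sum>i\<in>Basis. (V y \<bullet> i) *\<^sub>R M y i) x"
    using assms(2,3) by (intro smooth_at_sum smooth_at_scaleR smooth_at_inner_left)
qed

text \<open>The neighbourhood on which \<open>M x v\<close> is smooth may vary with v. Intersecting
  over the finitely many basis vectors and using linearity gives one that serves every v.\<close>

lemma smooth_at_linear_system: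
  fixes w :: "'e::real_normed_vector \<Rightarrow> 'b::euclidean_space" and M :: "'e \<Rightarrow> 'b \<Rightarrow> 'a::euclidean_space"
  assumes "\<forall>\<^sub>F y in nhds x. linear (M y) \<and> inj (M y) \<and> M y (w y) = c y"
    and "\<And>v. smooth_at (\<lambda>x. M x v) x" "smooth_at c x"
  shows "smooth_at w x"
proof -
  obtain T where T: "open T" "x \<in> T" "\<And>y. y \<in> T \<Longrightarrow> linear (M y) \<and> inj (M y) \<and> M y (w y) = c y"
    using assms(1) unfolding eventually_nhds by blast
  obtain R where R: "open R" "x \<in> R" "R \<subseteq> T" "\<forall>k. Ck_on k R c"
    by (rule smooth_atE[OF assms(3) T(1,2)])
  have "\<exists>S. open S \<and> x \<in> S \<and> S \<subseteq> R \<and> (\<forall>k. Ck_on k S (\<lambda>x. M x i))" for i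
    by (rule smooth_atE[OF assms(2)[of i] R(1,2)]) blast
  then obtain S where S: "\<And>i. open (S i)" "\<And>i. x \<in> S i" "\<And>i. S i \<subseteq> R"
      "\<And>i k. Ck_on k (S i) (\<lambda>x. M x i)"
    by metis
  define U where "U = (\<Inter>i\<in>(Basis::'b set). S i)"
  have U: "open U" "x \<in> U" "U \<subseteq> R"
    using S(1,2) by (auto simp: U_def) (meson S(3) SOME_Basis subsetD)
  have basis: "Ck_on k U (\<lambda>x. M x i)" if "i \<in> Basis" for i k
    using Ck_on_subset[OF _ S(4)] that unfolding U_def by blast
  have M: "Ck_on k U (\<lambda>x. M x v)" for v k
  proof (rule Ck_on_cong[OF U(1)])
    show "Ck_on k U (\<lambda>x. \<Sum>i\<in>Basis. (v \<bullet> i) *\<^sub>R M x i)"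
      using U(1) basis
        by (intro Ck_on_sum Ck_on_bounded_linear[OF bounded_linear_scaleR_right]) auto
    show "(\<Sum>i\<in>Basis. (v \<bullet> i) *\<^sub>R M y i) = M y v" if "y \<in> U" for y
      using T(3) R(3) U(3) that linear_basis_sum by (metis subsetD)
  qed
  show ?thesis
    by (rule smooth_atI[OF U(1,2)],
        rule Ck_on_linear_system[where M = M, OF U(1) _ _ M Ck_on_subset[OF U(3) R(4)[rule_format]]])
      (use T(3) R(3) U(3) in auto)
qed

lemma smooth_at_second_derivative_commute:
  fixes f :: "'e::real_normed_vector \<Rightarrow> 'f::euclidean_space"
  assumes "smooth_at f x"
  shows "frechet_derivative (\<lambda>y. frechet_derivative f (at y) u) (at x) v
       = frechet_derivative (\<lambda>y. frechet_derivative f (at y) v) (at x) u"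
  by (rule smooth_atE[OF assms open_UNIV UNIV_I]) (intro Ck_on_2_commute, auto simp del: Ck_on.simps)

section \<open>Charts, tangent vectors and connections\<close>

lemma has_derivative_cong_nhds:
  assumes "\<forall>\<^sub>F y in nhds x. f y = g y"
  shows "(f has_derivative f') (at x) \<longleftrightarrow> (g has_derivative f') (at x)"
proof -
  obtain S where S: "open S" "x \<in> S" "\<And>y. y \<in> S \<Longrightarrow> f y = g y"
    using assms unfolding eventually_nhds by blast
  show ?thesis
    using has_derivative_transform_within_open[OF _ S(1,2)] S(3) by (metis (no_types, lifting))
qed

locale manifold =
  fixes A :: "('m::{second_countable_topology,t2_space}, 'a::euclidean_space) chart set"
  assumes smooth_manifold: "smooth_manifold A"
begin

abbreviation dom :: "'m \<Rightarrow> 'm set" where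
  "dom p \<equiv> fst (chart_at A p)"

section \<open>Coordinate changes\<close>

text \<open>Common form of \<open>components\<close> and \<open>coord_field\<close>, so that their
  being mutually inverse becomes an instance of the cocycle rule
  \<open>jacobian_trans\<close>.\<close>

definition jacobian :: "'m \<Rightarrow> 'm \<Rightarrow> 'm \<Rightarrow> 'a \<Rightarrow> 'a" where
  "jacobian p r q = frechet_derivative (coord A p \<circ> coord_inv A r) (at (coord A r q))"

lemma components_jacobian: "components A p q = jacobian p q q"
  by (simp add: fun_eq_iff components_def tderiv_def jacobian_def)

lemma coord_field_jacobian: "coord_field A p v q = jacobian q p q v"
  by (simp add: coord_field_def jacobian_def)

lemma chart_at: "chart_at A p \<in> A" "p \<in> dom p"
proof -
  have "\<exists>c. c \<in> A \<and> p \<in> fst c"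
    using smooth_manifold unfolding smooth_manifold_def by blast
  from someI_ex[OF this] show "chart_at A p \<in> A" "p \<in> dom p"
    unfolding chart_at_def by blast+
qed

lemma open_dom: "open (dom p)"
  and open_coord_image: "open (coord A p ` dom p)"
  and homeomorphism_coord: "homeomorphism (dom p) (coord A p ` dom p) (coord A p) (coord_inv A p)"
  using smooth_manifold chart_at(1)[of p] unfolding smooth_manifold_def coord_def coord_inv_def by blast+

lemma coord_inv_coord [simp]: "q \<in> dom p \<Longrightarrow> coord_inv A p (coord A p q) = q"
  using homeomorphism_apply1[OF homeomorphism_coord] .

lemma eventually_dom: "q \<in> dom p \<Longrightarrow> \<forall>\<^sub>F r in nhds q. r \<in> dom p"
  using eventually_nhds_in_open[OF open_dom] .

lemma filterlim_coord_inv: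
  assumes "q \<in> dom p" shows "filterlim (coord_inv A p) (nhds q) (nhds (coord A p q))"
  using continuous_on_eq_continuous_at[OF open_coord_image, of p "coord_inv A p"]
    homeomorphism_cont2[OF homeomorphism_coord] assms
  by (auto simp: isCont_def tendsto_at_iff_tendsto_nhds)

lemma eventually_coord_inv:
  "\<forall>\<^sub>F r in nhds q. P r \<Longrightarrow> q \<in> dom p \<Longrightarrow> \<forall>\<^sub>F u in nhds (coord A p q). P (coord_inv A p u)"
  using filterlim_coord_inv unfolding filterlim_iff by blast

lemma eventually_coord_coord_inv:
  "q \<in> dom p \<Longrightarrow> \<forall>\<^sub>F u in nhds (coord A p q). coord A p (coord_inv A p u) = u"
  using eventually_nhds_in_open[OF open_coord_image]
  by (rule eventually_mono) (auto intro: homeomorphism_apply2[OF homeomorphism_coord])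

text \<open>The coordinate map is a homeomorphism, so neighbourhoods of p inside the chart
  correspond to neighbourhoods of its coordinates; smoothness on the manifold becomes a statement
  about germs.\<close>

lemma smooth_near_iff:
  fixes F :: "'m \<Rightarrow> 'f::real_normed_vector"
  shows "smooth_near A p F \<longleftrightarrow> smooth_at (F \<circ> coord_inv A p) (coord A p p)"
proof
  assume "smooth_near A p F"
  then obtain W where W: "open W" "p \<in> W" "W \<subseteq> dom p" "smooth_on (coord A p ` W) (F \<circ> coord_inv A p)"
    unfolding smooth_near_def by blast
  have "coord A p ` W = coord A p ` dom p \<inter> coord_inv A p -` W"
    using W(3) homeomorphism_apply1[OF homeomorphism_coord, of _ p] by force
  then have "open (coord A p ` W)"
    using continuous_open_preimage[OF homeomorphism_cont2[OF homeomorphism_coord]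
      open_coord_image W(1)] by simp
  then show "smooth_at (F \<circ> coord_inv A p) (coord A p p)"
    using W unfolding smooth_at_def by blast
next
  assume "smooth_at (F \<circ> coord_inv A p) (coord A p p)"
  then obtain S where S: "open S" "coord A p p \<in> S" "smooth_on S (F \<circ> coord_inv A p)"
    unfolding smooth_at_def by blast
  let ?W = "dom p \<inter> coord A p -` S"
  have "open ?W"
    using continuous_open_preimage[OF homeomorphism_cont1[OF homeomorphism_coord] open_dom S(1)] .
  moreover have "smooth_on (coord A p ` ?W) (F \<circ> coord_inv A p)"
    using S(3) Ck_on_subset[of "coord A p ` ?W" S] unfolding smooth_on_def by blast
  ultimately show "smooth_near A p F"
    using S(2) chart_at(2) unfolding smooth_near_def by blast
qed

lemma smooth_near_cong:
  assumes "\<forall>\<^sub>F q in nhds p. F q = G q" "smooth_near A p F"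
  shows "smooth_near A p G"
  using smooth_at_cong[of "F \<circ> coord_inv A p" "G \<circ> coord_inv A p"] assms
    eventually_coord_inv[OF assms(1) chart_at(2)]
  unfolding smooth_near_iff by simp

lemma smooth_at_transition:
  assumes "q \<in> dom p" "q \<in> dom r"
  shows "smooth_at (coord A p \<circ> coord_inv A r) (coord A r q)"
proof -
  have sm: "smooth_on (coord A r ` (dom r \<inter> dom p)) (coord A p \<circ> coord_inv A r)"
    using smooth_manifold chart_at(1) unfolding smooth_manifold_def coord_def coord_inv_def by blast
  have "coord A r ` (dom r \<inter> dom p) = coord A r ` dom r \<inter> coord_inv A r -` dom p"
    using homeomorphism_apply1[OF homeomorphism_coord, of _ r] by force
  then have "open (coord A r ` (dom r \<inter> dom p))"
    using continuous_open_preimage[OF homeomorphism_cont2[OF homeomorphism_coord]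
      open_coord_image open_dom]
    by simp
  with sm assms show ?thesis
    unfolding smooth_at_def by blast
qed

lemma has_derivative_transition:
  "q \<in> dom p \<Longrightarrow> q \<in> dom r \<Longrightarrow>
    ((coord A p \<circ> coord_inv A r) has_derivative jacobian p r q) (at (coord A r q))"
  unfolding jacobian_def using smooth_at_has_derivative[OF smooth_at_transition] .

text \<open>Chain rule through the transition map. Inserting the second chart leaves F unchanged
  only near q, which is all that a derivative sees.\<close>

lemma has_derivative_change_chart:
  assumes "q \<in> dom p" "q \<in> dom r" "((F \<circ> coord_inv A r) has_derivative F') (at (coord A r q))"
  shows "((F \<circ> coord_inv A p) has_derivative (\<lambda>v. F' (jacobian r p q v))) (at (coord A p q))"
proof -
  have D: "((\<lambda>u. (F \<circ> coord_inv A r) ((coord A r \<circ> coord_inv A p) u)) has_derivative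
      (\<lambda>v. F' (jacobian r p q v))) (at (coord A p q))"
    by (rule has_derivative_compose[OF has_derivative_transition])
      (use assms in \<open>simp_all add: comp_def\<close>)
  have "\<forall>\<^sub>F u in nhds (coord A p q).
      (F \<circ> coord_inv A r) ((coord A r \<circ> coord_inv A p) u) = (F \<circ> coord_inv A p) u"
    using eventually_coord_inv[OF eventually_dom[OF assms(2)] assms(1)]
    by eventually_elim simp
  from iffD1[OF has_derivative_cong_nhds[OF this] D] show ?thesis .
qed

lemma jacobian_refl:
  assumes "q \<in> dom p" shows "jacobian p p q v = v"
proof -
  have "((\<lambda>u. u) has_derivative (\<lambda>v. v)) (at (coord A p q))" by simp
  then have "((coord A p \<circ> coord_inv A p) has_derivative (\<lambda>v. v)) (at (coord A p q))"
    by (subst has_derivative_cong_nhds[of _ "\<lambda>u. u"]) (use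
      eventually_coord_coord_inv[OF assms] in simp_all)
  then show ?thesis
    using has_derivative_unique has_derivative_transition[OF assms assms] by metis
qed

text \<open>The transition map from s to p has one derivative, computed directly and through
  r.\<close>

lemma jacobian_trans:
  assumes "q \<in> dom p" "q \<in> dom r" "q \<in> dom s"
  shows "jacobian p r q (jacobian r s q v) = jacobian p s q v"
  using has_derivative_unique[OF has_derivative_transition[OF assms(1,3)]
      has_derivative_change_chart[OF assms(3,2) has_derivative_transition[OF assms(1,2)]]]
  by metis

lemma linear_jacobian: "q \<in> dom p \<Longrightarrow> q \<in> dom r \<Longrightarrow> linear (jacobian p r q)"
  using has_derivative_linear[OF has_derivative_transition] .

lemma linear_components: "q \<in> dom p \<Longrightarrow> linear (components A p q)"
  by (simp add: components_jacobian linear_jacobian chart_at)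

lemma components_coord_field [simp]: "q \<in> dom p \<Longrightarrow> components A p q (coord_field A p v q) = v"
  by (simp add: components_jacobian coord_field_jacobian jacobian_trans jacobian_refl chart_at)

lemma coord_field_components [simp]: "q \<in> dom p \<Longrightarrow> coord_field A p (components A p q v) q = v"
  by (simp add: components_jacobian coord_field_jacobian jacobian_trans jacobian_refl chart_at)

lemma components_self [simp]: "components A p p v = v"
  by (simp add: components_jacobian jacobian_refl chart_at)

lemma coord_field_self [simp]: "coord_field A p v p = v"
  by (simp add: coord_field_jacobian jacobian_refl chart_at)

lemma linear_coord_field: "q \<in> dom p \<Longrightarrow> linear (\<lambda>v. coord_field A p v q)"
  by (simp add: coord_field_jacobian linear_jacobian chart_at)

section \<open>Directional derivatives and smooth vector fields\<close>

lemma tderiv_eqI: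
  "((F \<circ> coord_inv A p) has_derivative F') (at (coord A p p)) \<Longrightarrow> tderiv A p v F = F' v"
  unfolding tderiv_def using frechet_derivative_at by metis

lemma smooth_near_has_derivative:
  "smooth_near A p F \<Longrightarrow> ((F \<circ> coord_inv A p) has_derivative (\<lambda>v. tderiv A p v F)) (at (coord A p p))"
  unfolding smooth_near_iff tderiv_def using smooth_at_has_derivative[of "F \<circ> coord_inv A p"]
    by simp

lemma linear_tderiv: "smooth_near A p F \<Longrightarrow> linear (\<lambda>v. tderiv A p v F)"
  using has_derivative_linear[OF smooth_near_has_derivative] .

text \<open>\<open>frechet_derivative\<close> is a choice among all derivatives at a point, so
  functions with the same derivatives there receive the same value, differentiable or not.\<close>

lemma tderiv_cong:
  assumes "\<forall>\<^sub>F q in nhds p. F q = G q"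
  shows "tderiv A p v F = tderiv A p v G"
proof -
  have "((F \<circ> coord_inv A p) has_derivative F') (at (coord A p p)) =
        ((G \<circ> coord_inv A p) has_derivative F') (at (coord A p p))" for F'
    using eventually_coord_inv[OF assms chart_at(2)]
    by (intro has_derivative_cong_nhds) simp
  then show ?thesis by (simp add: tderiv_def frechet_derivative_def)
qed

lemma smooth_near_const: "smooth_near A p (\<lambda>q. c)"
  unfolding smooth_near_iff comp_def by (rule smooth_at_const)

lemma tderiv_const: "tderiv A p v (\<lambda>q. c) = 0"
  by (rule tderiv_eqI) (simp add: comp_def)

lemma smooth_near_add: "smooth_near A p F \<Longrightarrow> smooth_near A p G \<Longrightarrow> smooth_near A p (\<lambda>q. F q + G q)"
  unfolding smooth_near_iff comp_def by (rule smooth_at_add)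

lemma tderiv_add:
  "smooth_near A p F \<Longrightarrow> smooth_near A p G \<Longrightarrow>
    tderiv A p v (\<lambda>q. F q + G q) = tderiv A p v F + tderiv A p v G"
  using has_derivative_add[OF smooth_near_has_derivative smooth_near_has_derivative]
  by (intro tderiv_eqI) (simp add: comp_def)

lemma smooth_near_bounded_linear:
  "bounded_linear L \<Longrightarrow> smooth_near A p F \<Longrightarrow> smooth_near A p (\<lambda>q. L (F q))"
  unfolding smooth_near_iff comp_def by (rule smooth_at_bounded_linear)

lemma tderiv_bounded_linear:
  "bounded_linear L \<Longrightarrow> smooth_near A p F \<Longrightarrow> tderiv A p v (\<lambda>q. L (F q)) = L (tderiv A p v F)"
  using bounded_linear.has_derivative[OF _ smooth_near_has_derivative]
  by (intro tderiv_eqI) (simp add: comp_def)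

lemma smooth_near_bounded_bilinear:
  "bounded_bilinear B \<Longrightarrow> smooth_near A p F \<Longrightarrow> smooth_near A p G \<Longrightarrow> smooth_near A p (\<lambda>q. B (F q) (G q))"
  unfolding smooth_near_iff comp_def by (rule smooth_at_bounded_bilinear)

lemma tderiv_bounded_bilinear:
  assumes "bounded_bilinear B" "smooth_near A p F" "smooth_near A p G"
  shows "tderiv A p v (\<lambda>q. B (F q) (G q)) = B (F p) (tderiv A p v G) + B (tderiv A p v F) (G p)"
  using bounded_bilinear.FDERIV[OF assms(1) smooth_near_has_derivative[OF assms(2)]
    smooth_near_has_derivative[OF assms(3)]]
  by (intro tderiv_eqI) (simp add: comp_def chart_at)

lemmas smooth_near_scaleR = smooth_near_bounded_bilinear[OF bounded_bilinear_scaleR]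
lemmas tderiv_scaleR = tderiv_bounded_bilinear[OF bounded_bilinear_scaleR]
lemmas smooth_near_mult = smooth_near_bounded_bilinear[OF bounded_bilinear_mult]
lemmas tderiv_mult = tderiv_bounded_bilinear[OF bounded_bilinear_mult]

lemma smooth_vf_cong:
  assumes "\<forall>\<^sub>F q in nhds p. X q = Y q" "smooth_vf A p X"
  shows "smooth_vf A p Y"
  using assms(2) unfolding smooth_vf_def
  by (rule smooth_near_cong[rotated]) (use assms(1) in eventually_elim, simp)

lemma smooth_vf_coord_field: "smooth_vf A p (coord_field A p v)"
  unfolding smooth_vf_def
  by (rule smooth_near_cong[OF _ smooth_near_const[of _ v]])
    (use eventually_dom[OF chart_at(2)] in eventually_elim, simp)

lemma smooth_vf_zero: "smooth_vf A p (\<lambda>q. 0)"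
  unfolding smooth_vf_def
  by (rule smooth_near_cong[OF _ smooth_near_const[of _ 0]])
    (use eventually_dom[OF chart_at(2)] in eventually_elim, simp add:
      linear_0[OF linear_components])

lemma smooth_vf_add:
  assumes "smooth_vf A p X" "smooth_vf A p Y" shows "smooth_vf A p (\<lambda>q. X q + Y q)"
  unfolding smooth_vf_def
  by (rule smooth_near_cong[OF _ smooth_near_add[OF assms[unfolded smooth_vf_def]]])
    (use eventually_dom[OF chart_at(2)] in eventually_elim, simp add:
      linear_add[OF linear_components])

lemma smooth_vf_scaleR:
  assumes "smooth_near A p f" "smooth_vf A p Y" shows "smooth_vf A p (\<lambda>q. f q *\<^sub>R Y q)"
  unfolding smooth_vf_def
  by (rule smooth_near_cong[OF _ smooth_near_scaleR[OF assms[unfolded smooth_vf_def]]])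
    (use eventually_dom[OF chart_at(2)] in eventually_elim, simp add:
      linear_cmul[OF linear_components])

lemma smooth_vf_minus: "smooth_vf A p Y \<Longrightarrow> smooth_vf A p (\<lambda>q. - Y q)"
  using smooth_vf_scaleR[OF smooth_near_const[of _ "-1"]] by simp

lemma smooth_vf_sum:
  "(\<And>i. i \<in> I \<Longrightarrow> smooth_vf A p (X i)) \<Longrightarrow> smooth_vf A p (\<lambda>q. \<Sum>i\<in>I. X i q)"
  by (induction I rule: infinite_finite_induct) (auto intro: smooth_vf_zero smooth_vf_add)

lemma smooth_near_component:
  "smooth_vf A p Y \<Longrightarrow> smooth_near A p (\<lambda>q. components A p q (Y q) \<bullet> i)"
  unfolding smooth_vf_def by (rule smooth_near_bounded_linear[OF bounded_linear_inner_left])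

lemma coord_field_expansion:
  "q \<in> dom p \<Longrightarrow> (\<Sum>i\<in>Basis. (components A p q v \<bullet> i) *\<^sub>R coord_field A p i q) = v"
  using linear_basis_sum[OF linear_coord_field, of q p "components A p q v"] by simp

text \<open>Near p every smooth field is a combination of the coordinate fields of one chart with
  smooth coefficients, so stability under sums, scaling and change away from p reduces a property to
  coordinate fields.\<close>

lemma smooth_vf_induct [consumes 1, case_names coord_field add scaleR cong]:
  assumes Y: "smooth_vf A p Y" and "\<And>v. P (coord_field A p v)"
    and "\<And>Y Z. smooth_vf A p Y \<Longrightarrow> smooth_vf A p Z \<Longrightarrow> P Y \<Longrightarrow> P Z \<Longrightarrow> P (\<lambda>q. Y q + Z q)"
    and "\<And>f Y. smooth_near A p f \<Longrightarrow> smooth_vf A p Y \<Longrightarrow> P Y \<Longrightarrow> P (\<lambda>q. f q *\<^sub>R Y q)"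
    and "\<And>Y Z. smooth_vf A p Y \<Longrightarrow> \<forall>\<^sub>F q in nhds p. Y q = Z q \<Longrightarrow> P Y \<Longrightarrow> P Z"
  shows "P Y"
proof -
  let ?Z = "\<lambda>I q. \<Sum>i\<in>I. (components A p q (Y q) \<bullet> i) *\<^sub>R coord_field A p i q"
  note field = smooth_vf_scaleR[OF smooth_near_component[OF Y] smooth_vf_coord_field]
  have Z: "smooth_vf A p (?Z I)" for I by (rule smooth_vf_sum[OF field])
  have step: "P (?Z I)" if "finite I" for I
    using that
  proof induction
    case empty
    \<comment> \<open>The zero field is reached as 0 times a coordinate field, so the rule has no
      case of its own for it.\<close>
    then show ?case
      using assms(4)[OF smooth_near_const[of _ 0] smooth_vf_coord_field assms(2)] by simp
  next
    case (insert i I)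
    show ?case
      using assms(3)[OF field Z assms(4)[OF
        smooth_near_component[OF Y] smooth_vf_coord_field assms(2)] insert.IH]
      by (simp only: sum.insert[OF insert.hyps])
  qed
  have "\<forall>\<^sub>F q in nhds p. ?Z Basis q = Y q"
    using eventually_dom[OF chart_at(2)] by eventually_elim (simp add: coord_field_expansion)
  from assms(5)[OF Z this step[OF finite_Basis]] show ?thesis .
qed

lemma tderiv_components_coord_field: "tderiv A p x (\<lambda>q. components A p q (coord_field A p v q)) = 0"
  by (subst tderiv_cong[where G = "\<lambda>q. v"])
    (use eventually_dom[OF chart_at(2)] in eventually_elim, simp_all add: tderiv_const)

lemma lie_bracket_coord_field: "lie_bracket A (coord_field A p v) (coord_field A p w) p = 0"
  by (simp add: lie_bracket_def tderiv_components_coord_field)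

end

section \<open>Affine and Levi-Civita connections\<close>

locale connection = manifold A
  for A :: "('m::{second_countable_topology,t2_space}, 'a::euclidean_space) chart set" +
  fixes D :: "'m \<Rightarrow> 'a \<Rightarrow> ('m \<Rightarrow> 'a) \<Rightarrow> 'a"
  assumes affine: "affine_connection A D"
begin

lemma D_add: "smooth_vf A p Y \<Longrightarrow> smooth_vf A p Z \<Longrightarrow> D p x (\<lambda>q. Y q + Z q) = D p x Y + D p x Z"
  and D_scaleR: "smooth_near A p f \<Longrightarrow> smooth_vf A p Y \<Longrightarrow>
        D p x (\<lambda>q. f q *\<^sub>R Y q) = tderiv A p x f *\<^sub>R Y p + f p *\<^sub>R D p x Y"
  and smooth_vf_D: "smooth_vf A p X \<Longrightarrow> smooth_vf A p Y \<Longrightarrow> smooth_vf A p (\<lambda>q. D q (X q) Y)"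
  using affine unfolding affine_connection_def by blast+

lemma D_zero: "D p x (\<lambda>q. 0) = 0"
  using D_add[OF smooth_vf_zero smooth_vf_zero, of p x] by simp

lemma D_minus: "smooth_vf A p Y \<Longrightarrow> D p x (\<lambda>q. - Y q) = - D p x Y"
  using D_scaleR[OF smooth_near_const[of _ "-1"]] by (simp add: tderiv_const)

text \<open>Locality needs no bump function: the discontinuous function vanishing exactly where the two
  fields agree is smooth near p.\<close>

lemma D_cong:
  assumes "\<forall>\<^sub>F q in nhds p. Y q = Z q" and Y: "smooth_vf A p Y"
  shows "D p x Y = D p x Z"
proof -
  have Z: "smooth_vf A p Z" by (rule smooth_vf_cong[OF assms])
  define u :: "'m \<Rightarrow> real" where "u q = (if Y q = Z q then 0 else 1)" for q
  have u: "\<forall>\<^sub>F q in nhds p. 0 = u q"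
    using assms(1) by eventually_elim (simp add: u_def)
  have su: "smooth_near A p u"
    by (rule smooth_near_cong[OF u smooth_near_const])
  have diff: "smooth_vf A p (\<lambda>q. Y q + - Z q)"
    by (intro smooth_vf_add smooth_vf_minus Y Z)
  have "D p x Y - D p x Z = D p x (\<lambda>q. Y q + - Z q)"
    using D_add[OF Y smooth_vf_minus[OF Z], of x] D_minus[OF Z, of x] by simp
  also have "(\<lambda>q. Y q + - Z q) = (\<lambda>q. u q *\<^sub>R (Y q + - Z q))"
    by (auto simp: u_def)
  also have "D p x \<dots> = 0"
    using D_scaleR[OF su diff] tderiv_cong[OF u, of x] eventually_nhds_x_imp_x[OF u]
    by (simp add: tderiv_const eventually_nhds_x_imp_x[OF assms(1)])
  finally show ?thesis by simp
qed

lemma D_sum: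
  "(\<And>i. i \<in> I \<Longrightarrow> smooth_vf A p (Y i)) \<Longrightarrow> D p x (\<lambda>q. \<Sum>i\<in>I. Y i q) = (\<Sum>i\<in>I. D p x (Y i))"
  by (induction I rule: infinite_finite_induct) (simp_all add: D_zero D_add smooth_vf_sum)

text \<open>The coordinate formula that \<open>pullback_connection\<close> imitates; matching the
  two gives \<open>pullback_compose\<close>.\<close>

lemma D_expansion:
  assumes "smooth_vf A p Y"
  shows "D p x Y = tderiv A p x (\<lambda>q. components A p q (Y q))
    + (\<Sum>i\<in>Basis. (Y p \<bullet> i) *\<^sub>R D p x (coord_field A p i))"
proof -
  let ?c = "\<lambda>i q. components A p q (Y q) \<bullet> i"
  have c: "smooth_near A p (?c i)" for i by (rule smooth_near_component[OF assms])
  note field = smooth_vf_scaleR[OF c smooth_vf_coord_field]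
  have "D p x Y = D p x (\<lambda>q. \<Sum>i\<in>Basis. ?c i q *\<^sub>R coord_field A p i q)"
    by (rule D_cong[OF _ assms], use eventually_dom[OF chart_at(2)] in eventually_elim)
      (simp add: coord_field_expansion)
  also have "\<dots> = (\<Sum>i\<in>Basis. tderiv A p x (?c i) *\<^sub>R i + (Y p \<bullet> i) *\<^sub>R D p x (coord_field A p i))"
    by (simp add: D_sum[OF field] D_scaleR[OF c smooth_vf_coord_field])
  also have "\<dots> = (\<Sum>i\<in>Basis. (tderiv A p x (\<lambda>q. components A p q (Y q)) \<bullet> i) *\<^sub>R i)
      + (\<Sum>i\<in>Basis. (Y p \<bullet> i) *\<^sub>R D p x (coord_field A p i))"
    by (simp add: sum.distrib tderiv_bounded_linear[OF bounded_linear_inner_left assms[unfolded smooth_vf_def]])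
  finally show ?thesis by (simp add: euclidean_representation)
qed

end

locale levi_civita_connection = manifold A
  for A :: "('m::{second_countable_topology,t2_space}, 'a::euclidean_space) chart set" +
  fixes g :: "'m \<Rightarrow> 'a \<Rightarrow> 'a \<Rightarrow> real" and D :: "'m \<Rightarrow> 'a \<Rightarrow> ('m \<Rightarrow> 'a) \<Rightarrow> 'a"
  assumes levi_civita: "levi_civita A g D"
begin

sublocale connection A D
  by unfold_locales (use levi_civita in \<open>simp add: levi_civita_def\<close>)

lemma torsion_free: "smooth_vf A p X \<Longrightarrow> smooth_vf A p Y \<Longrightarrow>
    lie_bracket A X Y p = D p (X p) Y - D p (Y p) X"
  and metric_compatible: "smooth_vf A p Y \<Longrightarrow> smooth_vf A p Z \<Longrightarrow>
    tderiv A p x (\<lambda>q. g q (Y q) (Z q)) = g p (D p x Y) (Z p) + g p (Y p) (D p x Z)"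
  using levi_civita unfolding levi_civita_def by metis+

text \<open>Symmetry of the Christoffel symbols: coordinate fields commute, so torsion-freeness
  leaves no bracket.\<close>

lemma D_coord_field_commute: "D p v (coord_field A p w) = D p w (coord_field A p v)"
  using torsion_free[OF smooth_vf_coord_field smooth_vf_coord_field, of p v w]
  by (simp add: lie_bracket_coord_field)

end

locale riemannian_connection = levi_civita_connection +
  assumes riemannian: "riemannian_metric A g"
begin

lemma bilinear_metric: "bilinear (g p)" and metric_commute: "g p x y = g p y x"
  and metric_pos: "x \<noteq> 0 \<Longrightarrow> g p x x > 0"
  and smooth_near_metric:
    "smooth_vf A p X \<Longrightarrow> smooth_vf A p Y \<Longrightarrow> smooth_near A p (\<lambda>q. g q (X q) (Y q))"
  using riemannian unfolding riemannian_metric_def by blast+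

lemmas metric_linear = bilinear_radd[OF bilinear_metric] bilinear_rmul[OF bilinear_metric]
  bilinear_rsub[OF bilinear_metric] bilinear_rzero[OF bilinear_metric]

end

section \<open>Vector fields along an immersion\<close>

locale immersed_manifold = A: connection A D + B: manifold B
  for A :: "('m::{second_countable_topology,t2_space}, 'a::euclidean_space) chart set"
    and D :: "'m \<Rightarrow> 'a \<Rightarrow> ('m \<Rightarrow> 'a) \<Rightarrow> 'a"
    and B :: "('k::{second_countable_topology,t2_space}, 'b::euclidean_space) chart set" +
  fixes \<iota> :: "'k \<Rightarrow> 'm"
  assumes immersion: "immersion B A \<iota>"
begin

abbreviation d\<iota> :: "'k \<Rightarrow> 'b \<Rightarrow> 'a" where "d\<iota> \<equiv> differential B A \<iota>"

abbreviation pullback :: "'k \<Rightarrow> 'b \<Rightarrow> ('k \<Rightarrow> 'a) \<Rightarrow> 'a" where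
  "pullback \<equiv> pullback_connection B A \<iota> D"

definition local_rep :: "'k \<Rightarrow> 'b \<Rightarrow> 'a" where
  "local_rep p = (coord A (\<iota> p) \<circ> \<iota>) \<circ> coord_inv B p"

text \<open>Smooth sections of the pullback of the ambient tangent bundle, read in the frame of the
  chart at \<open>\<iota> p\<close>.\<close>

definition smooth_along :: "'k \<Rightarrow> ('k \<Rightarrow> 'a) \<Rightarrow> bool" where
  "smooth_along p V \<longleftrightarrow> smooth_near B p (\<lambda>q. components A (\<iota> p) (\<iota> q) (V q))"

lemma smooth_local_rep: "smooth_near B p (coord A (\<iota> p) \<circ> \<iota>)"
  and inj_differential: "inj (d\<iota> p)"
  using immersion unfolding immersion_def by blast+

lemma smooth_at_local_rep: "smooth_at (local_rep p) (coord B p p)"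
  using smooth_local_rep unfolding B.smooth_near_iff local_rep_def .

lemma filterlim_immersion: "filterlim \<iota> (nhds (\<iota> p)) (nhds p)"
  using immersion unfolding immersion_def
  by (simp add: continuous_on_eq_continuous_at isCont_def tendsto_at_iff_tendsto_nhds)

lemma eventually_immersion: "\<forall>\<^sub>F q in nhds (\<iota> p). P q \<Longrightarrow> \<forall>\<^sub>F q in nhds p. P (\<iota> q)"
  using filterlim_immersion unfolding filterlim_iff by blast

lemma eventually_near: "\<forall>\<^sub>F q in nhds p. q \<in> B.dom p \<and> \<iota> q \<in> A.dom (\<iota> p)"
  by (intro eventually_conj B.eventually_dom eventually_immersion A.eventually_dom A.chart_at B.chart_at)

lemma linear_differential: "linear (d\<iota> p)"
  using B.linear_tderiv[OF smooth_local_rep] unfolding differential_def .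

lemma has_derivative_compose_immersion:
  assumes "((G \<circ> coord_inv A (\<iota> p)) has_derivative G') (at (coord A (\<iota> p) (\<iota> p)))"
  shows "((G \<circ> \<iota> \<circ> coord_inv B p) has_derivative (\<lambda>v. G' (d\<iota> p v))) (at (coord B p p))"
proof -
  have D: "((\<lambda>u. (G \<circ> coord_inv A (\<iota> p)) ((coord A (\<iota> p) \<circ> \<iota> \<circ> coord_inv B p) u)) has_derivative
      (\<lambda>v. G' (d\<iota> p v))) (at (coord B p p))"
    by (rule has_derivative_compose[OF
      B.smooth_near_has_derivative[OF smooth_local_rep, folded differential_def]])
      (use assms in \<open>simp add: comp_def B.chart_at\<close>)
  have "\<forall>\<^sub>F u in nhds (coord B p p).
      (G \<circ> coord_inv A (\<iota> p)) ((coord A (\<iota> p) \<circ> \<iota> \<circ> coord_inv B p) u) = (G \<circ> \<iota> \<circ> coord_inv B p) u"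
    using B.eventually_coord_inv[OF eventually_near B.chart_at(2)] by eventually_elim simp
  from iffD1[OF has_derivative_cong_nhds[OF this] D] show ?thesis .
qed

lemma tderiv_compose_immersion:
  assumes "smooth_near A (\<iota> p) G"
  shows "tderiv B p x (\<lambda>q. G (\<iota> q)) = tderiv A (\<iota> p) (d\<iota> p x) G"
proof (rule B.tderiv_eqI)
  show "(((\<lambda>q. G (\<iota> q)) \<circ> coord_inv B p) has_derivative (\<lambda>v. tderiv A (\<iota> p) (d\<iota> p v) G)) (at (coord B p p))"
    using has_derivative_compose_immersion[OF A.smooth_near_has_derivative[OF assms]]
      by (simp add: comp_def)
qed

lemma smooth_near_compose_immersion:
  assumes "smooth_near A (\<iota> p) G" shows "smooth_near B p (\<lambda>q. G (\<iota> q))"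
  unfolding B.smooth_near_iff
proof (rule smooth_at_cong)
  show "smooth_at (\<lambda>u. (G \<circ> coord_inv A (\<iota> p)) (local_rep p u)) (coord B p p)"
    by (rule smooth_at_compose[OF smooth_at_local_rep])
      (use assms in \<open>simp add: A.smooth_near_iff local_rep_def B.chart_at comp_def\<close>)
  show "\<forall>\<^sub>F u in nhds (coord B p p).
      (G \<circ> coord_inv A (\<iota> p)) (local_rep p u) = ((\<lambda>q. G (\<iota> q)) \<circ> coord_inv B p) u"
    using B.eventually_coord_inv[OF eventually_near B.chart_at(2)]
    by eventually_elim (simp add: local_rep_def)
qed

text \<open>The charts singled out at q and \<open>\<iota> q\<close> need not be those at p and
  \<open>\<iota> p\<close>. In the latter two, fixed charts, the differentials at all nearby q
  become derivatives of the single map \<open>local_rep p\<close>, which makes their dependence on q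
  smooth.\<close>

lemma has_derivative_local_rep:
  assumes "q \<in> B.dom p" "\<iota> q \<in> A.dom (\<iota> p)"
  shows "(local_rep p has_derivative (\<lambda>v. components A (\<iota> p) (\<iota> q) (d\<iota> q (coord_field B p v q))))
    (at (coord B p q))"
  using B.has_derivative_change_chart[OF assms(1) B.chart_at(2) has_derivative_compose_immersion
    [OF A.has_derivative_transition[OF assms(2) A.chart_at(2)]]]
  by (simp add: local_rep_def B.coord_field_jacobian A.components_jacobian comp_assoc)

lemma components_differential:
  assumes "q \<in> B.dom p" "\<iota> q \<in> A.dom (\<iota> p)"
  shows "components A (\<iota> p) (\<iota> q) (d\<iota> q y)
    = frechet_derivative (local_rep p) (at (coord B p q)) (components B p q y)"
  using frechet_derivative_at[OF has_derivative_local_rep[OF assms], THEN fun_cong, of "components B p q y"] assms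
  by simp

lemma eventually_components_differential:
  "\<forall>\<^sub>F q in nhds p. components A (\<iota> p) (\<iota> q) (d\<iota> q (Y q))
    = frechet_derivative (local_rep p) (at (coord B p q)) (components B p q (Y q))"
  using eventually_near[of p] by eventually_elim (simp add: components_differential)

lemma smooth_along_differential:
  assumes "smooth_vf B p Y" shows "smooth_along p (\<lambda>q. d\<iota> q (Y q))"
  unfolding smooth_along_def B.smooth_near_iff
proof (rule smooth_at_cong)
  show "smooth_at (\<lambda>u. frechet_derivative (local_rep p) (at u) (((\<lambda>q. components B p q (Y q)) \<circ> coord_inv B p) u))
      (coord B p p)"
    by (rule smooth_at_linear_apply[OF eventually_mono[OF
      eventually_smooth_at[OF smooth_at_local_rep] smooth_at_linear]
          smooth_at_frechet_derivative[OF smooth_at_local_rep] assms[unfolded smooth_vf_def B.smooth_near_iff]])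
  show "\<forall>\<^sub>F u in nhds (coord B p p).
      frechet_derivative (local_rep p) (at u) (((\<lambda>q. components B p q (Y q)) \<circ> coord_inv B p) u)
      = ((\<lambda>q. components A (\<iota> p) (\<iota> q) (d\<iota> q (Y q))) \<circ> coord_inv B p) u"
    using B.eventually_coord_inv[OF eventually_components_differential[of p Y] B.chart_at(2)]
      B.eventually_coord_coord_inv[OF B.chart_at(2)]
    by eventually_elim simp
qed

text \<open>Recovering Y from its image under the differential is a linear system whose matrix, the
  derivative of \<open>local_rep p\<close>, is smooth and injective near p. This is what makes
  \<open>\<xi>M\<close> smooth.\<close>

lemma smooth_vf_differentialD:
  assumes "smooth_along p (\<lambda>q. d\<iota> q (Y q))" shows "smooth_vf B p Y"
  unfolding smooth_vf_def B.smooth_near_iff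
proof (rule smooth_at_linear_system[where M = "\<lambda>u. frechet_derivative (local_rep p) (at u)"])
  show "smooth_at ((\<lambda>q. components A (\<iota> p) (\<iota> q) (d\<iota> q (Y q))) \<circ> coord_inv B p) (coord B p p)"
    using assms unfolding smooth_along_def B.smooth_near_iff .
  show "smooth_at (\<lambda>u. frechet_derivative (local_rep p) (at u) v) (coord B p p)" for v
    by (rule smooth_at_frechet_derivative[OF smooth_at_local_rep])
  have inj: "inj (frechet_derivative (local_rep p) (at (coord B p q)))"
    if "q \<in> B.dom p" "\<iota> q \<in> A.dom (\<iota> p)" for q
  proof (rule injI)
    fix v w
    assume "frechet_derivative (local_rep p) (at (coord B p q)) v
      = frechet_derivative (local_rep p) (at (coord B p q)) w"
    then have "components A (\<iota> p) (\<iota> q) (d\<iota> q (coord_field B p v q))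
      = components A (\<iota> p) (\<iota> q) (d\<iota> q (coord_field B p w q))"
      using that by (simp add: components_differential)
    then show "v = w"
      using that inj_differential[of q]
      by (metis A.coord_field_components B.components_coord_field injD)
  qed
  show "\<forall>\<^sub>F u in nhds (coord B p p). linear (frechet_derivative (local_rep p) (at u))
      \<and> inj (frechet_derivative (local_rep p) (at u))
      \<and> frechet_derivative (local_rep p) (at u) (((\<lambda>q. components B p q (Y q)) \<circ> coord_inv B p) u)
        = ((\<lambda>q. components A (\<iota> p) (\<iota> q) (d\<iota> q (Y q))) \<circ> coord_inv B p) u"
    using B.eventually_coord_inv[OF eventually_near B.chart_at(2)]
      B.eventually_coord_coord_inv[OF B.chart_at(2)] eventually_smooth_at[OF smooth_at_local_rep]
  proof eventually_elim
    case (elim u)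
    let ?q = "coord_inv B p u"
    have q: "?q \<in> B.dom p" "\<iota> ?q \<in> A.dom (\<iota> p)" using elim(1) by auto
    show ?case
      using inj[OF q] components_differential[OF q, of "Y ?q"]
        smooth_at_linear[OF elim(3)] elim(2) by simp
  qed
qed

section \<open>Sections along the immersion and their covariant derivative\<close>

lemma smooth_along_cong:
  assumes "\<forall>\<^sub>F q in nhds p. V q = W q" "smooth_along p V"
  shows "smooth_along p W"
  using assms(2) unfolding smooth_along_def
  by (rule B.smooth_near_cong[rotated]) (use assms(1) in eventually_elim, simp)

lemma smooth_along_compose: "smooth_vf A (\<iota> p) Z \<Longrightarrow> smooth_along p (\<lambda>q. Z (\<iota> q))"
  unfolding smooth_along_def smooth_vf_def by (rule smooth_near_compose_immersion)

lemma eventually_components_add: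
  "\<forall>\<^sub>F q in nhds p. components A (\<iota> p) (\<iota> q) (V q) + components A (\<iota> p) (\<iota> q) (W q)
    = components A (\<iota> p) (\<iota> q) (V q + W q)"
  using eventually_near[of p] by eventually_elim (simp add: linear_add[OF A.linear_components])

lemma eventually_components_scaleR:
  "\<forall>\<^sub>F q in nhds p. f q *\<^sub>R components A (\<iota> p) (\<iota> q) (V q) = components A (\<iota> p) (\<iota> q) (f q *\<^sub>R V q)"
  using eventually_near[of p] by eventually_elim (simp add: linear_cmul[OF A.linear_components])

lemma smooth_along_add: "smooth_along p V \<Longrightarrow> smooth_along p W \<Longrightarrow> smooth_along p (\<lambda>q. V q + W q)"
  unfolding smooth_along_def
  by (rule B.smooth_near_cong[OF eventually_components_add B.smooth_near_add])

lemma smooth_along_scaleR: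
  "smooth_near B p f \<Longrightarrow> smooth_along p V \<Longrightarrow> smooth_along p (\<lambda>q. f q *\<^sub>R V q)"
  unfolding smooth_along_def
  by (rule B.smooth_near_cong[OF eventually_components_scaleR B.smooth_near_scaleR])

lemma smooth_along_sum:
  "(\<And>i. i \<in> I \<Longrightarrow> smooth_along p (V i)) \<Longrightarrow> smooth_along p (\<lambda>q. \<Sum>i\<in>I. V i q)"
  by (induction I rule: infinite_finite_induct)
    (auto intro: smooth_along_add smooth_along_compose[OF A.smooth_vf_zero])

text \<open>The coordinate fields of the chart at \<open>\<iota> p\<close>, restricted along
  \<iota>, form a frame near p; the coefficients are functions on the submanifold. Properties of the
  pullback connection thus reduce to restrictions of ambient fields.\<close>

lemma smooth_along_induct [consumes 1, case_names field add scaleR cong]: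
  assumes V: "smooth_along p V" and field: "\<And>Z. smooth_vf A (\<iota> p) Z \<Longrightarrow> P (\<lambda>q. Z (\<iota> q))"
    and add: "\<And>V W. smooth_along p V \<Longrightarrow> smooth_along p W \<Longrightarrow> P V \<Longrightarrow> P W \<Longrightarrow> P (\<lambda>q. V q + W q)"
    and scaleR: "\<And>f V. smooth_near B p f \<Longrightarrow> smooth_along p V \<Longrightarrow> P V \<Longrightarrow> P (\<lambda>q. f q *\<^sub>R V q)"
    and cong: "\<And>V W. smooth_along p V \<Longrightarrow> \<forall>\<^sub>F q in nhds p. V q = W q \<Longrightarrow> P V \<Longrightarrow> P W"
  shows "P V"
proof -
  let ?c = "\<lambda>i q. components A (\<iota> p) (\<iota> q) (V q) \<bullet> i" and ?E = "\<lambda>i. coord_field A (\<iota> p) i"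
  let ?Z = "\<lambda>I q. \<Sum>i\<in>I. ?c i q *\<^sub>R ?E i (\<iota> q)"
  have c: "smooth_near B p (?c i)" for i
    using V unfolding smooth_along_def by (rule
      B.smooth_near_bounded_linear[OF bounded_linear_inner_left])
  note E = smooth_along_compose[OF A.smooth_vf_coord_field]
  have Z: "smooth_along p (?Z I)" for I by (intro smooth_along_sum smooth_along_scaleR c E)
  have step: "P (?Z I)" if "finite I" for I
    using that
  proof induction
    case empty
    then show ?case using field[OF A.smooth_vf_zero] by simp
  next
    case (insert i I)
    show ?case
      using add[OF smooth_along_scaleR[OF c E] Z scaleR[OF c E field[OF A.smooth_vf_coord_field]]
        insert.IH]
      by (simp only: sum.insert[OF insert.hyps])
  qed
  have "\<forall>\<^sub>F q in nhds p. ?Z Basis q = V q"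
    using eventually_near by eventually_elim (simp add: A.coord_field_expansion)
  from cong[OF Z this step[OF finite_Basis]] show ?thesis .
qed

lemma pullback_cong:
  assumes "\<forall>\<^sub>F q in nhds p. V q = W q" shows "pullback p x V = pullback p x W"
proof -
  have "\<forall>\<^sub>F q in nhds p. components A (\<iota> p) (\<iota> q) (V q) = components A (\<iota> p) (\<iota> q) (W q)"
    using assms by eventually_elim simp
  from B.tderiv_cong[OF this] eventually_nhds_x_imp_x[OF assms] show ?thesis
    by (simp add: pullback_connection_def)
qed

lemma pullback_add:
  assumes "smooth_along p V" "smooth_along p W"
  shows "pullback p x (\<lambda>q. V q + W q) = pullback p x V + pullback p x W"
  using B.tderiv_add[OF assms[unfolded smooth_along_def], of x] B.tderiv_cong[OF
    eventually_components_add[of p V W], of x]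
  by (simp add: pullback_connection_def inner_add_left scaleR_add_left sum.distrib)

lemma pullback_scaleR:
  assumes "smooth_near B p f" "smooth_along p V"
  shows "pullback p x (\<lambda>q. f q *\<^sub>R V q) = tderiv B p x f *\<^sub>R V p + f p *\<^sub>R pullback p x V"
  using B.tderiv_scaleR[OF assms[unfolded smooth_along_def], of x] B.tderiv_cong[OF
    eventually_components_scaleR[where p = p and f = f and V = V], of x]
  by (simp add: pullback_connection_def scaleR_add_right scaleR_sum_right)

lemma pullback_compose:
  assumes "smooth_vf A (\<iota> p) Z" shows "pullback p x (\<lambda>q. Z (\<iota> q)) = D (\<iota> p) (d\<iota> p x) Z"
  using tderiv_compose_immersion[OF assms[unfolded smooth_vf_def], of x]
    A.D_expansion[OF assms, of "d\<iota> p x"]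
  by (simp add: pullback_connection_def)

lemma pullback_zero: "pullback p x (\<lambda>q. 0) = 0"
  using pullback_compose[OF A.smooth_vf_zero, of p x] by (simp add: A.D_zero)

text \<open>Metric compatibility passes to the pullback connection. Induction over V and then W
  reduces it to ambient fields; smoothness is carried along because the sum and product rules in the
  induction steps require it.\<close>

lemma smooth_near_tensor_along:
  assumes "\<And>q. bilinear (g q)"
    and "\<And>q X Y. smooth_vf A q X \<Longrightarrow> smooth_vf A q Y \<Longrightarrow> smooth_near A q (\<lambda>q. g q (X q) (Y q))"
    and "\<And>q x Y Z. smooth_vf A q Y \<Longrightarrow> smooth_vf A q Z \<Longrightarrow>
      tderiv A q x (\<lambda>q. g q (Y q) (Z q)) = g q (D q x Y) (Z q) + g q (Y q) (D q x Z)"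
    and V: "smooth_along p V" and W: "smooth_along p W"
  shows "smooth_near B p (\<lambda>q. g (\<iota> q) (V q) (W q) :: real) \<and>
    tderiv B p x (\<lambda>q. g (\<iota> q) (V q) (W q)) = g (\<iota> p) (pullback p x V) (W p) + g (\<iota> p) (V p) (pullback p x W)"
  using V
proof (induction rule: smooth_along_induct)
  case Y: (field Y)
  from W show ?case
  proof (induction rule: smooth_along_induct)
    case (field Z)
    then show ?case
      using smooth_near_compose_immersion[OF assms(2)[OF Y field]]
        tderiv_compose_immersion[OF assms(2)[OF Y field], of x] assms(3)[OF Y field]
      by (simp add: pullback_compose Y)
  next
    case (add V W)
    then show ?case
      using B.smooth_near_add[of p "\<lambda>q. g (\<iota> q) (Y (\<iota> q)) (V q)" "\<lambda>q. g (\<iota> q) (Y (\<iota> q)) (W q)"]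
        B.tderiv_add[of p "\<lambda>q. g (\<iota> q) (Y (\<iota> q)) (V q)" "\<lambda>q. g (\<iota> q) (Y (\<iota> q)) (W q)" x]
      by (simp add: pullback_add bilinear_radd[OF assms(1)])
  next
    case (scaleR f V)
    then show ?case
      using B.smooth_near_mult[where p = p and F = f and G = "\<lambda>q. g (\<iota> q) (Y (\<iota> q)) (V q)"]
        B.tderiv_mult[where p = p and F = f and G = "\<lambda>q. g (\<iota> q) (Y (\<iota> q)) (V q)" and v = x]
      by (simp add: pullback_scaleR bilinear_radd[OF assms(1)] bilinear_rmul[OF assms(1)] algebra_simps)
  next
    case (cong V W)
    have ev: "\<forall>\<^sub>F q in nhds p. g (\<iota> q) (Y (\<iota> q)) (V q) = g (\<iota> q) (Y (\<iota> q)) (W q)"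
      using cong(2) by eventually_elim simp
    then show ?case
      using cong B.smooth_near_cong[OF ev] B.tderiv_cong[OF ev, of x]
        pullback_cong[OF cong(2), of x]
        eventually_nhds_x_imp_x[OF cong(2)] by simp
  qed
next
  case (add U V)
  then show ?case
    using B.smooth_near_add[of p "\<lambda>q. g (\<iota> q) (U q) (W q)" "\<lambda>q. g (\<iota> q) (V q) (W q)"]
      B.tderiv_add[of p "\<lambda>q. g (\<iota> q) (U q) (W q)" "\<lambda>q. g (\<iota> q) (V q) (W q)" x]
    by (simp add: pullback_add bilinear_ladd[OF assms(1)])
next
  case (scaleR f V)
  then show ?case
    using B.smooth_near_mult[where p = p and F = f and G = "\<lambda>q. g (\<iota> q) (V q) (W q)"]
      B.tderiv_mult[where p = p and F = f and G = "\<lambda>q. g (\<iota> q) (V q) (W q)" and v = x]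
    by (simp add: pullback_scaleR bilinear_ladd[OF assms(1)] bilinear_lmul[OF assms(1)] algebra_simps)
next
  case (cong U V)
  have ev: "\<forall>\<^sub>F q in nhds p. g (\<iota> q) (U q) (W q) = g (\<iota> q) (V q) (W q)"
    using cong(2) by eventually_elim simp
  then show ?case
    using cong B.smooth_near_cong[OF ev] B.tderiv_cong[OF ev, of x] pullback_cong[OF cong(2), of x]
      eventually_nhds_x_imp_x[OF cong(2)] by simp
qed

end

section \<open>The second fundamental form\<close>

locale isometric_immersion =
  A: riemannian_connection A g D +
  B: levi_civita_connection B "induced_metric B A \<iota> g" DM +
  immersed_manifold A D B \<iota>
  for A :: "('m::{second_countable_topology,t2_space}, 'a::euclidean_space) chart set"
    and g :: "'m \<Rightarrow> 'a \<Rightarrow> 'a \<Rightarrow> real" and D :: "'m \<Rightarrow> 'a \<Rightarrow> ('m \<Rightarrow> 'a) \<Rightarrow> 'a"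
    and B :: "('k::{second_countable_topology,t2_space}, 'b::euclidean_space) chart set"
    and \<iota> :: "'k \<Rightarrow> 'm" and DM :: "'k \<Rightarrow> 'b \<Rightarrow> ('k \<Rightarrow> 'b) \<Rightarrow> 'b"
begin

abbreviation h :: "'k \<Rightarrow> 'b \<Rightarrow> 'b \<Rightarrow> 'a" where
  "h \<equiv> second_fundamental_form B A \<iota> D DM"

text \<open>The Gauss formula with an arbitrary extension of the second argument; \<open>h\<close>
  is its value on coordinate fields, and \<open>sff_field_eq_h\<close> shows that only
  \<open>Y p\<close> matters.\<close>

definition sff_field :: "'k \<Rightarrow> 'b \<Rightarrow> ('k \<Rightarrow> 'b) \<Rightarrow> 'a" where
  "sff_field p x Y = pullback p x (\<lambda>q. d\<iota> q (Y q)) - d\<iota> p (DM p x Y)"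

lemma h_sff_field: "h p x y = sff_field p x (coord_field B p y)"
  by (simp add: second_fundamental_form_def sff_field_def Let_def)

lemma sff_field_cong:
  assumes "\<forall>\<^sub>F q in nhds p. Y q = Z q" "smooth_vf B p Y"
  shows "sff_field p x Y = sff_field p x Z"
proof -
  have "\<forall>\<^sub>F q in nhds p. d\<iota> q (Y q) = d\<iota> q (Z q)"
    using assms(1) by eventually_elim simp
  then show ?thesis
    unfolding sff_field_def using pullback_cong B.D_cong[OF assms] by metis
qed

lemma sff_field_add:
  assumes "smooth_vf B p Y" "smooth_vf B p Z"
  shows "sff_field p x (\<lambda>q. Y q + Z q) = sff_field p x Y + sff_field p x Z"
  using pullback_add[OF smooth_along_differential[OF assms(1)]
    smooth_along_differential[OF assms(2)]]
  by (simp add: sff_field_def B.D_add[OF assms] linear_add[OF linear_differential])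

text \<open>The derivative of f contributes the same multiple of the image of \<open>Y p\<close> to
  both terms of \<open>sff_field\<close>, and the contributions cancel.\<close>

lemma sff_field_scaleR:
  assumes "smooth_near B p f" "smooth_vf B p Y"
  shows "sff_field p x (\<lambda>q. f q *\<^sub>R Y q) = f p *\<^sub>R sff_field p x Y"
  using pullback_scaleR[OF assms(1) smooth_along_differential[OF assms(2)], of x]
  by (simp add: sff_field_def B.D_scaleR[OF assms] linear_add[OF linear_differential]
      linear_cmul[OF linear_differential] scaleR_diff_right)

lemma linear_h: "linear (h p x)"
proof (rule linearI)
  fix y z c
  have "\<forall>\<^sub>F q in nhds p. coord_field B p (y + z) q = coord_field B p y q + coord_field B p z q"
    using B.eventually_dom[OF B.chart_at(2)] by eventually_elim (simp add:
      linear_add[OF B.linear_coord_field])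
  from sff_field_cong[OF this B.smooth_vf_coord_field] show "h p x (y + z) = h p x y + h p x z"
    by (simp add: h_sff_field sff_field_add B.smooth_vf_coord_field)
  have "\<forall>\<^sub>F q in nhds p. coord_field B p (c *\<^sub>R y) q = c *\<^sub>R coord_field B p y q"
    using B.eventually_dom[OF B.chart_at(2)] by eventually_elim (simp add:
      linear_cmul[OF B.linear_coord_field])
  from sff_field_cong[OF this B.smooth_vf_coord_field] show "h p x (c *\<^sub>R y) = c *\<^sub>R h p x y"
    by (simp add: h_sff_field sff_field_scaleR[OF B.smooth_near_const] B.smooth_vf_coord_field)
qed

lemma sff_field_eq_h: "smooth_vf B p Y \<Longrightarrow> sff_field p x Y = h p x (Y p)"
proof (induction rule: B.smooth_vf_induct)
  case (coord_field v)
  show ?case by (simp add: h_sff_field)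
next
  case (add Y Z)
  then show ?case by (simp add: sff_field_add linear_add[OF linear_h])
next
  case (scaleR f Y)
  then show ?case by (simp add: sff_field_scaleR linear_cmul[OF linear_h])
next
  case (cong Y Z)
  then show ?case using sff_field_cong[OF cong(2,1)] eventually_nhds_x_imp_x[OF cong(2)] by metis
qed

section \<open>Symmetry and normality of h\<close>

text \<open>In the charts at p and \<open>\<iota> p\<close> the image of a coordinate field is a
  directional derivative of \<open>local_rep p\<close>; differentiating again gives the second
  derivative, and the ambient connection adds its Christoffel term.\<close>

lemma pullback_coord_field:
  "pullback p x (\<lambda>q. d\<iota> q (coord_field B p y q))
    = frechet_derivative (\<lambda>u. frechet_derivative (local_rep p) (at u) y) (at (coord B p p)) x
      + D (\<iota> p) (d\<iota> p x) (coord_field A (\<iota> p) (d\<iota> p y))"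
proof -
  let ?V = "\<lambda>q. components A (\<iota> p) (\<iota> q) (d\<iota> q (coord_field B p y q))"
  have ev: "\<forall>\<^sub>F u in nhds (coord B p p). frechet_derivative (local_rep p) (at u) y = (?V \<circ> coord_inv B p) u"
    using B.eventually_coord_inv[OF eventually_near B.chart_at(2)]
      B.eventually_coord_coord_inv[OF B.chart_at(2)]
    by eventually_elim (simp add: components_differential)
  have "tderiv B p x ?V
    = frechet_derivative (\<lambda>u. frechet_derivative (local_rep p) (at u) y) (at (coord B p p)) x"
    by (rule B.tderiv_eqI[OF iffD1[OF has_derivative_cong_nhds[OF ev]
        smooth_at_has_derivative[OF smooth_at_frechet_derivative[OF smooth_at_local_rep]]]])
  then show ?thesis
    using A.D_expansion[OF A.smooth_vf_coord_field, of "\<iota> p" "d\<iota> p x" "d\<iota> p y"]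
    by (simp add: pullback_connection_def A.tderiv_components_coord_field)
qed

text \<open>Three symmetric constituents: the second derivative of \<open>local_rep p\<close> by
  Schwarz, the ambient and intrinsic Christoffel terms by torsion-freeness. Tangent fields never
  have to be extended to ambient ones.\<close>

lemma h_commute: "h p x y = h p y x"
proof -
  have 1: "frechet_derivative (\<lambda>u. frechet_derivative (local_rep p) (at u) y) (at (coord B p p)) x
      = frechet_derivative (\<lambda>u. frechet_derivative (local_rep p) (at u) x) (at (coord B p p)) y"
    by (rule smooth_at_second_derivative_commute[OF smooth_at_local_rep])
  have 2: "D (\<iota> p) (d\<iota> p x) (coord_field A (\<iota> p) (d\<iota> p y)) = D (\<iota> p) (d\<iota> p y) (coord_field A (\<iota> p) (d\<iota> p x))"
    by (rule A.D_coord_field_commute)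
  have 3: "DM p x (coord_field B p y) = DM p y (coord_field B p x)"
    by (rule B.D_coord_field_commute)
  show ?thesis
    unfolding h_sff_field sff_field_def pullback_coord_field 1 2 3 by (rule refl)
qed

lemma tderiv_tensor_along:
  assumes "smooth_along p V" "smooth_along p W"
  shows "tderiv B p x (\<lambda>q. g (\<iota> q) (V q) (W q))
    = g (\<iota> p) (pullback p x V) (W p) + g (\<iota> p) (V p) (pullback p x W)"
  by (rule conjunct2[OF smooth_near_tensor_along])
    (fact A.bilinear_metric A.smooth_near_metric A.metric_compatible assms)+

text \<open>\<open>g(h(x,y),z)\<close> is symmetric in x, y (both connections are torsion free) and skew in y, z (both
  are metric), hence zero.\<close>

lemma h_normal: "g (\<iota> p) (h p x y) (d\<iota> p z) = 0"
proof -
  have skew: "g (\<iota> p) (h p x y) (d\<iota> p z) + g (\<iota> p) (h p x z) (d\<iota> p y) = 0" for x y z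
  proof -
    note E = B.smooth_vf_coord_field[of p]
    have "tderiv B p x (\<lambda>q. g (\<iota> q) (d\<iota> q (coord_field B p y q)) (d\<iota> q (coord_field B p z q)))
      = g (\<iota> p) (pullback p x (\<lambda>q. d\<iota> q (coord_field B p y q))) (d\<iota> p z)
        + g (\<iota> p) (d\<iota> p y) (pullback p x (\<lambda>q. d\<iota> q (coord_field B p z q)))"
      using tderiv_tensor_along[OF smooth_along_differential[OF E[of y]]
        smooth_along_differential[OF E[of z]], of x]
      by simp
    with B.metric_compatible[OF E E, of x y z]
    show ?thesis
      unfolding A.metric_commute[of "\<iota> p" "h p x z"]
      by (simp add: induced_metric_def h_sff_field sff_field_def bilinear_lsub[OF A.bilinear_metric]
          bilinear_rsub[OF A.bilinear_metric])
  qed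
  then show ?thesis
    \<comment> \<open>By symmetry of h the six permuted values reduce to three numbers, and skewness
      says that their pairwise sums are 0.\<close>
    using skew[of x y z] skew[of z x y] skew[of y z x]
    unfolding h_commute[of p z x] h_commute[of p y x] h_commute[of p z y] by linarith
qed

lemma normal_tangent_zero:
  assumes "\<And>x. g (\<iota> p) w (d\<iota> p x) = 0" "w \<in> range (d\<iota> p)" shows "w = 0"
  using assms A.metric_pos[of w "\<iota> p"] by force

lemma h_tangent_zero: "h p x y \<in> range (d\<iota> p) \<Longrightarrow> h p x y = 0"
  by (rule normal_tangent_zero[OF h_normal])

text \<open>\<open>normal_part\<close> is a definite description; at 0 its uniqueness holds because
  a vector both normal and tangent vanishes by positive definiteness.\<close>

lemma normal_connection_zero: "normal_connection B A \<iota> g D p x (\<lambda>q. 0) = 0"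
proof -
  have "normal_part B A \<iota> g p 0 = 0"
    unfolding normal_part_def
  proof (rule the_equality)
    show "(\<forall>x. g (\<iota> p) 0 (d\<iota> p x) = 0) \<and> 0 - 0 \<in> range (d\<iota> p)"
      using linear_0[OF linear_differential, of p] bilinear_lzero[OF A.bilinear_metric]
        by (metis diff_zero rangeI)
    show "w = 0" if "(\<forall>x. g (\<iota> p) w (d\<iota> p x) = 0) \<and> 0 - w \<in> range (d\<iota> p)" for w
    proof (rule normal_tangent_zero)
      from that have "- w \<in> range (d\<iota> p)" by simp
      then obtain v where "- w = d\<iota> p v" by (rule rangeE)
      then have "w = d\<iota> p (- v)" using linear_neg[OF linear_differential, of p v]
        by (metis minus_minus)
      then show "w \<in> range (d\<iota> p)" by blast
    qed (use that in blast)
  qed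
  then show ?thesis by (simp add: normal_connection_def pullback_zero)
qed

lemma curvature_normal_zero: "curvature B (normal_connection B A \<iota> g D) X Y (\<lambda>q. 0) p = 0"
  by (simp add: curvature_def normal_connection_zero)

end

section \<open>Invariant submanifolds of generalized Sasakian-space-forms\<close>

locale sasakian_space_form =
  fixes n :: nat
    and A :: "('m::{second_countable_topology,t2_space}, 'a::euclidean_space) chart set"
    and \<phi> \<xi> \<eta> g D and f1 f2 f3 :: "'m \<Rightarrow> real"
  assumes space_form: "generalized_sasakian_space_form n A \<phi> \<xi> \<eta> g D f1 f2 f3"
    and structure_eqs: "structure_equations A \<phi> \<xi> \<eta> g D f1 f3"
begin

lemma almost_contact: "almost_contact_metric A \<phi> \<xi> \<eta> g"
  and dimension: "n > 1" "DIM('a) = 2 * n + 1"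
  using space_form unfolding generalized_sasakian_space_form_def by blast+

sublocale riemannian_connection A g D
  using space_form almost_contact
  by unfold_locales (auto simp: generalized_sasakian_space_form_def almost_contact_metric_def)

lemma linear_phi: "linear (\<phi> p)" and smooth_phi: "smooth_vf A p X \<Longrightarrow> smooth_vf A p (\<lambda>q. \<phi> q (X q))"
  and smooth_xi: "smooth_vf A p \<xi>" and linear_eta: "linear (\<eta> p)"
  and phi_phi: "\<phi> p (\<phi> p x) = - x + \<eta> p x *\<^sub>R \<xi> p"
  and phi_xi: "\<phi> p (\<xi> p) = 0" and eta_xi: "\<eta> p (\<xi> p) = 1" and g_xi: "g p x (\<xi> p) = \<eta> p x"
  and g_phi_phi: "g p (\<phi> p x) (\<phi> p y) = g p x y - \<eta> p x * \<eta> p y"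
  and eta_phi: "\<eta> p (\<phi> p x) = 0"
  using almost_contact unfolding almost_contact_metric_def by blast+

lemma g_xi_left: "g p (\<xi> p) x = \<eta> p x"
  using g_xi metric_commute by metis

text \<open>Applying \<phi> to both arguments preserves g here, since \<eta> vanishes on the image
  of \<phi>, while \<phi> squared reverses the sign.\<close>

lemma g_x_phi: "g p x (\<phi> p x) = 0"
proof -
  have "g p (\<phi> p x) (\<phi> p (\<phi> p x)) = g p x (\<phi> p x)"
    by (simp add: g_phi_phi eta_phi)
  also have "g p (\<phi> p x) (\<phi> p (\<phi> p x)) = - g p x (\<phi> p x)"
    by (simp add: phi_phi metric_linear
        g_xi eta_phi metric_commute[of p "\<phi> p x" x])
  finally show ?thesis by simp
qed

definition f :: "'m \<Rightarrow> real" where "f p = f1 p - f3 p"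

lemma smooth_f: "smooth_near A p f"
  using space_form smooth_near_add[OF _
    smooth_near_bounded_linear[OF bounded_linear_minus[OF bounded_linear_ident]], of p f1 f3]
  unfolding generalized_sasakian_space_form_def f_def by auto

lemma D_phi:
  assumes "smooth_vf A p Y"
  shows "D p x (\<lambda>q. \<phi> q (Y q)) = \<phi> p (D p x Y) + f p *\<^sub>R (g p x (Y p) *\<^sub>R \<xi> p - \<eta> p (Y p) *\<^sub>R x)"
proof -
  have "D p x (\<lambda>q. \<phi> q (Y q)) - \<phi> p (D p x Y) = f p *\<^sub>R (g p x (Y p) *\<^sub>R \<xi> p - \<eta> p (Y p) *\<^sub>R x)"
    using structure_eqs assms unfolding structure_equations_def f_def by blast
  then show ?thesis unfolding diff_eq_eq by (simp only: add.commute)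
qed

lemma D_xi: "D p x \<xi> = - (f p *\<^sub>R \<phi> p x)"
  using structure_eqs unfolding structure_equations_def f_def by blast

lemma curvature_formula:
  assumes "smooth_vf A p X" "smooth_vf A p Y" "smooth_vf A p Z"
  shows "curvature A D X Y Z p =
          f1 p *\<^sub>R (g p (Y p) (Z p) *\<^sub>R X p - g p (X p) (Z p) *\<^sub>R Y p)
        + f2 p *\<^sub>R (g p (X p) (\<phi> p (Z p)) *\<^sub>R \<phi> p (Y p)
                  - g p (Y p) (\<phi> p (Z p)) *\<^sub>R \<phi> p (X p)
                  + (2 * g p (X p) (\<phi> p (Y p))) *\<^sub>R \<phi> p (Z p))
        + f3 p *\<^sub>R ((\<eta> p (X p) * \<eta> p (Z p)) *\<^sub>R Y p
                  - (\<eta> p (Y p) * \<eta> p (Z p)) *\<^sub>R X p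
                  + (g p (X p) (Z p) * \<eta> p (Y p)) *\<^sub>R \<xi> p
                  - (g p (Y p) (Z p) * \<eta> p (X p)) *\<^sub>R \<xi> p)"
  using space_form assms unfolding generalized_sasakian_space_form_def by blast

lemma exists_eta_zero: "\<exists>x::'a. x \<noteq> 0 \<and> \<eta> p x = 0"
proof (rule ccontr)
  assume "\<not> ?thesis"
  then have "inj (\<eta> p)"
    using linear_injective_0[OF linear_eta] by blast
  then have "dim (range (\<eta> p)) = DIM('a)"
    using dim_image_eq[OF linear_eta, of p UNIV] by (simp add: inj_on_subset)
  then show False
    using dim_subset_UNIV[of "range (\<eta> p)"] dimension by simp
qed

text \<open>As f is a function, differentiating - f \<phi>X along \<xi> produces the derivative of
  f. It occurs only as a multiple of \<phi>x, which is orthogonal to x, so pairing with x removes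
  it; the covariant derivative of X along \<xi> cancels against the bracket term.\<close>

lemma f_idem: "f p * f p = f p"
proof -
  \<comment> \<open>A direction in the kernel of \<eta> reduces the curvature formula to f1 - f3
    times x.\<close>
  obtain x where x: "x \<noteq> 0" "\<eta> p x = 0" using exists_eta_zero by blast
  let ?X = "coord_field A p x"
  note X = smooth_vf_coord_field[of p x]
  \<comment> \<open>The derivative of \<xi> along itself is - f \<phi>\<xi>, the zero field.\<close>
  have 1: "D p (?X p) (\<lambda>q. D q (\<xi> q) \<xi>) = 0"
    by (simp add: D_xi phi_xi D_zero)
  have "D p (\<xi> p) (\<lambda>q. D q (?X q) \<xi>) = D p (\<xi> p) (\<lambda>q. - (f q *\<^sub>R \<phi> q (?X q)))"
    by (simp add: D_xi)
  also have "\<dots> = - (tderiv A p (\<xi> p) f *\<^sub>R \<phi> p x + f p *\<^sub>R \<phi> p (D p (\<xi> p) ?X))"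
    using D_minus[OF smooth_vf_scaleR[OF smooth_f smooth_phi[OF X]]] D_scaleR[OF smooth_f
      smooth_phi[OF X]]
      D_phi[OF X] by (simp add: g_xi_left x(2))
  finally have 2: "D p (\<xi> p) (\<lambda>q. D q (?X q) \<xi>)
    = - (tderiv A p (\<xi> p) f *\<^sub>R \<phi> p x + f p *\<^sub>R \<phi> p (D p (\<xi> p) ?X))" .
  have "D p (lie_bracket A ?X \<xi> p) \<xi> = - (f p *\<^sub>R \<phi> p (- (f p *\<^sub>R \<phi> p x) - D p (\<xi> p) ?X))"
    by (simp add: torsion_free[OF X smooth_xi] D_xi)
  also have "\<dots> = - ((f p * f p) *\<^sub>R x) + f p *\<^sub>R \<phi> p (D p (\<xi> p) ?X)"
    by (simp add: linear_diff[OF linear_phi] linear_neg[OF linear_phi]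
      linear_cmul[OF linear_phi] phi_phi x(2)
        algebra_simps)
  finally have "curvature A D ?X \<xi> \<xi> p = tderiv A p (\<xi> p) f *\<^sub>R \<phi> p x + (f p * f p) *\<^sub>R x"
    unfolding curvature_def 1 2 by simp
  moreover have "curvature A D ?X \<xi> \<xi> p = f p *\<^sub>R x"
    using curvature_formula[OF X smooth_xi smooth_xi]
    by (simp add: g_xi x(2) eta_xi phi_xi metric_linear f_def algebra_simps)
  ultimately have "f p *\<^sub>R x = tderiv A p (\<xi> p) f *\<^sub>R \<phi> p x + (f p * f p) *\<^sub>R x" by simp
  then have "g p x (f p *\<^sub>R x) = g p x (tderiv A p (\<xi> p) f *\<^sub>R \<phi> p x + (f p * f p) *\<^sub>R x)" by simp
  then have "f p * g p x x = f p * f p * g p x x"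
    by (simp add: metric_linear g_x_phi)
  then show ?thesis using metric_pos[OF x(1), of p] by simp
qed

end

locale invariant_submanifold_space_form =
  sasakian_space_form n A \<phi> \<xi> \<eta> g D f1 f2 f3 + isometric_immersion A g D B \<iota> DM
  for n and A :: "('m::{second_countable_topology,t2_space}, 'a::euclidean_space) chart set"
    and \<phi> \<xi> \<eta> g D f1 f2 f3
    and B :: "('k::{second_countable_topology,t2_space}, 'b::euclidean_space) chart set"
    and \<iota> DM +
  assumes invariant: "invariant_submanifold B A \<iota> \<phi> \<xi>"
    and f_nonzero: "f1 (\<iota> p) \<noteq> f3 (\<iota> p)"
begin

lemma f_one: "f (\<iota> p) = 1"
  using f_idem[of "\<iota> p"] f_nonzero[of p] by (simp add: f_def)

section \<open>The structure induced on the submanifold\<close>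

text \<open>Invariance puts the argument of \<open>inv\<close> into the range of the differential,
  so no arbitrary value of \<open>inv\<close> occurs; likewise for \<open>\<phi>M\<close>.\<close>

definition \<xi>M :: "'k \<Rightarrow> 'b" where "\<xi>M q = inv (d\<iota> q) (\<xi> (\<iota> q))"

definition \<phi>M :: "'k \<Rightarrow> 'b \<Rightarrow> 'b" where "\<phi>M q x = inv (d\<iota> q) (\<phi> (\<iota> q) (d\<iota> q x))"

lemma differential_xi: "d\<iota> q (\<xi>M q) = \<xi> (\<iota> q)"
  using invariant unfolding invariant_submanifold_def \<xi>M_def by (simp add: f_inv_into_f)

lemma differential_phi: "d\<iota> q (\<phi>M q x) = \<phi> (\<iota> q) (d\<iota> q x)"
  using invariant unfolding invariant_submanifold_def \<phi>M_def by (intro f_inv_into_f) blast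

lemma differential_eq_iff: "d\<iota> q x = d\<iota> q y \<longleftrightarrow> x = y"
  using inj_differential by (rule inj_eq)

lemmas differential_linear = linear_add[OF linear_differential] linear_diff[OF linear_differential]
  linear_neg[OF linear_differential] linear_cmul[OF linear_differential]
    linear_0[OF linear_differential]

lemmas phi_linear = linear_add[OF linear_phi] linear_diff[OF linear_phi]
  linear_neg[OF linear_phi] linear_cmul[OF linear_phi] linear_0[OF linear_phi]

lemma smooth_xiM: "smooth_vf B p \<xi>M"
  by (rule smooth_vf_differentialD) (simp add: differential_xi smooth_along_compose smooth_xi)

lemma sff_field_xi: "sff_field p x \<xi>M = d\<iota> p (- \<phi>M p x - DM p x \<xi>M)"
  by (simp add: sff_field_def differential_xi pullback_compose[OF smooth_xi] D_xi f_one
      differential_linear differential_phi)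

lemma h_xi: "h p x (\<xi>M p) = 0"
  using h_tangent_zero sff_field_eq_h[OF smooth_xiM] sff_field_xi by (metis rangeI)

lemma DM_xi: "DM p x \<xi>M = - \<phi>M p x"
proof -
  have "d\<iota> p (- \<phi>M p x - DM p x \<xi>M) = d\<iota> p 0"
    using h_xi[of p x] sff_field_eq_h[OF smooth_xiM, of p x] sff_field_xi[of p x]
      by (simp add: differential_linear(5))
  then show ?thesis unfolding differential_eq_iff by simp
qed

text \<open>The failure of the pullback connection to commute with \<phi> is linear over functions
  on the submanifold, and so is the right-hand side; hence the structure equation extends from
  ambient fields to all sections along \<iota>. The factor f1 - f3 is already 1 there.\<close>

lemma pullback_phi:
  assumes "smooth_along p V"
  shows "smooth_along p (\<lambda>q. \<phi> (\<iota> q) (V q)) \<and>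
    pullback p x (\<lambda>q. \<phi> (\<iota> q) (V q)) = \<phi> (\<iota> p) (pullback p x V)
      + (g (\<iota> p) (d\<iota> p x) (V p) *\<^sub>R \<xi> (\<iota> p) - \<eta> (\<iota> p) (V p) *\<^sub>R d\<iota> p x)"
  using assms
proof (induction rule: smooth_along_induct)
  case (field Z)
  show ?case
    using smooth_along_compose[OF smooth_phi[OF field]] pullback_compose[OF
      smooth_phi[OF field], of x]
      pullback_compose[OF field, of x] D_phi[OF field] by (simp add: f_one)
next
  case (add V W)
  then show ?case
    by (simp add: phi_linear smooth_along_add pullback_add metric_linear
        linear_add[OF linear_eta] algebra_simps)
next
  case (scaleR k V)
  then show ?case
    by (simp add: phi_linear smooth_along_scaleR pullback_scaleR metric_linear
        linear_cmul[OF linear_eta] scaleR_add_right scaleR_diff_right)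
next
  case (cong V W)
  have ev: "\<forall>\<^sub>F q in nhds p. \<phi> (\<iota> q) (V q) = \<phi> (\<iota> q) (W q)"
    using cong(2) by eventually_elim simp
  from cong smooth_along_cong[OF ev] pullback_cong[OF ev, of x] pullback_cong[OF cong(2), of x]
    eventually_nhds_x_imp_x[OF cong(2)] show ?case by simp
qed

text \<open>\<open>\<phi>M\<close> applied to X is minus the covariant derivative of
  \<open>\<xi>M\<close> along X, so smoothness comes from the connection.\<close>

lemma smooth_phiM:
  assumes "smooth_vf B p X" shows "smooth_vf B p (\<lambda>q. \<phi>M q (X q))"
  using B.smooth_vf_minus[OF B.smooth_vf_D[OF assms smooth_xiM]] by (simp add: DM_xi)

text \<open>By symmetry h(\<xi>,X) = h(X,\<xi>) = 0: in the direction \<xi>, ambient and intrinsic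
  derivatives of tangent fields agree. This lets the ambient structure equation determine intrinsic
  curvature.\<close>

lemma pullback_xi_eq_DM: "smooth_vf B p X \<Longrightarrow> pullback p (\<xi>M p) (\<lambda>q. d\<iota> q (X q)) = d\<iota> p (DM p (\<xi>M p) X)"
  using sff_field_eq_h[of p X "\<xi>M p"] h_xi[of p "X p"] h_commute[of p "\<xi>M p"]
    by (simp add: sff_field_def)

text \<open>In the direction \<xi> the correction in \<open>pullback_phi\<close> is g(\<xi>,X)\<xi>
  - \<eta>(X)\<xi> = 0.\<close>

lemma DM_xi_phi:
  assumes "smooth_vf B p X"
  shows "DM p (\<xi>M p) (\<lambda>q. \<phi>M q (X q)) = \<phi>M p (DM p (\<xi>M p) X)"
proof -
  have "d\<iota> p (DM p (\<xi>M p) (\<lambda>q. \<phi>M q (X q))) = pullback p (\<xi>M p) (\<lambda>q. \<phi> (\<iota> q) (d\<iota> q (X q)))"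
    using pullback_xi_eq_DM[OF smooth_phiM[OF assms]] by (simp add: differential_phi)
  also have "\<dots> = \<phi> (\<iota> p) (d\<iota> p (DM p (\<xi>M p) X))"
    using pullback_phi[OF smooth_along_differential[OF assms], of "\<xi>M p"]
    by (simp add: pullback_xi_eq_DM[OF assms] differential_xi g_xi_left)
  finally show ?thesis
    by (simp add: differential_phi[symmetric] differential_eq_iff)
qed

text \<open>With X' the derivative of X along \<xi>, the second curvature term is \<phi>X' and the
  bracket term is \<phi>(- \<phi>X - X'), while the first is 0. Only minus the square of \<phi> at X
  remains.\<close>

lemma curvature_xi:
  assumes "smooth_vf B p X"
  shows "curvature B DM X \<xi>M \<xi>M p = X p - \<eta> (\<iota> p) (d\<iota> p (X p)) *\<^sub>R \<xi>M p"
proof -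
  have "\<phi>M q (\<xi>M q) = 0" for q
    using differential_phi[of q "\<xi>M q"] differential_eq_iff[of q _ 0]
      by (simp add: differential_xi phi_xi differential_linear)
  then have "curvature B DM X \<xi>M \<xi>M p = \<phi>M p (DM p (\<xi>M p) X) + \<phi>M p (- \<phi>M p (X p) - DM p (\<xi>M p) X)"
    using B.D_minus[OF smooth_phiM[OF assms], of "\<xi>M p"]
    by (simp add: curvature_def DM_xi B.D_zero DM_xi_phi[OF assms]
      B.torsion_free[OF assms smooth_xiM])
  then have "d\<iota> p (curvature B DM X \<xi>M \<xi>M p) = d\<iota> p (X p - \<eta> (\<iota> p) (d\<iota> p (X p)) *\<^sub>R \<xi>M p)"
    by (simp add: differential_linear differential_phi phi_linear phi_phi differential_xi)
  then show ?thesis by (simp add: differential_eq_iff)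
qed

section \<open>Semiparallel and totally geodesic\<close>

lemma semiparallel_h_zero:
  assumes "concircularly_semiparallel n B A \<iota> g D DM"
    and "scalar_curvature B (induced_metric B A \<iota> g) DM p \<noteq> 2 * real n * (2 * real n + 1)"
  shows "h p z y = 0"
proof -
  let ?C = "concircular_curvature n B (induced_metric B A \<iota> g) DM"
  let ?c = "scalar_curvature B (induced_metric B A \<iota> g) DM p / (2 * real n * (2 * real n + 1))"
  let ?Y = "coord_field B p y" and ?Z = "coord_field B p z"
  note E = B.smooth_vf_coord_field[of p]
  \<comment> \<open>In the first two terms \<xi> fills a slot of h, so only the third
    survives.\<close>
  have "curvature B (normal_connection B A \<iota> g D) ?Y \<xi>M (\<lambda>q. h q (?Z q) (\<xi>M q)) p
         - h p (?C ?Y \<xi>M ?Z p) (\<xi>M p) - h p (?Z p) (?C ?Y \<xi>M \<xi>M p) = 0"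
    using assms(1) E smooth_xiM unfolding concircularly_semiparallel_def Let_def by blast
  then have "h p z (?C ?Y \<xi>M \<xi>M p) = 0"
    by (simp add: h_xi curvature_normal_zero)
  \<comment> \<open>R(y,\<xi>)\<xi> and the metric term of C are the same vector y - \<eta>(y)\<xi>,
    whence the common factor; its \<xi>-part is then killed by \<open>h_xi\<close>.\<close>
  also have "?C ?Y \<xi>M \<xi>M p = (1 - ?c) *\<^sub>R (y - \<eta> (\<iota> p) (d\<iota> p y) *\<^sub>R \<xi>M p)"
    by (simp add: concircular_curvature_def curvature_xi[OF E] induced_metric_def
        differential_xi g_xi eta_xi algebra_simps)
  finally have "(1 - ?c) *\<^sub>R h p z y = 0"
    by (simp add: linear_cmul[OF linear_h] linear_diff[OF linear_h] h_xi)
  moreover have "1 - ?c \<noteq> 0" using assms(2) dimension(1) by (simp add: field_simps)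
  ultimately show ?thesis unfolding scaleR_eq_0_iff by blast
qed

lemma totally_geodesic_semiparallel:
  assumes "totally_geodesic B A \<iota> D DM" shows "concircularly_semiparallel n B A \<iota> g D DM"
  using assms unfolding totally_geodesic_def concircularly_semiparallel_def Let_def
  by (simp add: curvature_normal_zero)

end

theorem theorem3p2:
  fixes A :: "('m::{second_countable_topology,t2_space}, 'a::euclidean_space) chart set"
    and B :: "('k::{second_countable_topology,t2_space}, 'b::euclidean_space) chart set"
    and \<iota> :: "'k \<Rightarrow> 'm" and n :: nat
    and \<phi> :: "'m \<Rightarrow> 'a \<Rightarrow> 'a" and \<xi> :: "'m \<Rightarrow> 'a" and \<eta> :: "'m \<Rightarrow> 'a \<Rightarrow> real"
    and g :: "'m \<Rightarrow> 'a \<Rightarrow> 'a \<Rightarrow> real"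
    and D :: "'m \<Rightarrow> 'a \<Rightarrow> ('m \<Rightarrow> 'a) \<Rightarrow> 'a"
    and DM :: "'k \<Rightarrow> 'b \<Rightarrow> ('k \<Rightarrow> 'b) \<Rightarrow> 'b"
    and f1 f2 f3 :: "'m \<Rightarrow> real"
  assumes "generalized_sasakian_space_form n A \<phi> \<xi> \<eta> g D f1 f2 f3"
    and "structure_equations A \<phi> \<xi> \<eta> g D f1 f3"
    and "smooth_manifold B"
    and "immersion B A \<iota>"
    and "invariant_submanifold B A \<iota> \<phi> \<xi>"
    and "levi_civita B (induced_metric B A \<iota> g) DM"
    and "\<And>p. f1 (\<iota> p) \<noteq> f3 (\<iota> p)"
    and "\<And>p. scalar_curvature B (induced_metric B A \<iota> g) DM p \<noteq>
               2 * real n * (2 * real n + 1) * (f1 (\<iota> p) - f3 (\<iota> p))"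
  shows "totally_geodesic B A \<iota> D DM \<longleftrightarrow> concircularly_semiparallel n B A \<iota> g D DM"
proof -
  interpret sasakian_space_form n A \<phi> \<xi> \<eta> g D f1 f2 f3
    using assms(1,2) by unfold_locales
  interpret invariant_submanifold_space_form n A \<phi> \<xi> \<eta> g D f1 f2 f3 B \<iota> DM
    using assms(3-7) by unfold_locales
  \<comment> \<open>At f = 1 the excluded value 2n(2n+1)(f1 - f3) becomes 2n(2n+1).\<close>
  have "scalar_curvature B (induced_metric B A \<iota> g) DM p \<noteq> 2 * real n * (2 * real n + 1)" for p
    using assms(8)[of p] f_one[of p] by (simp add: f_def)
  then show ?thesis
    using semiparallel_h_zero totally_geodesic_semiparallel unfolding totally_geodesic_def by blast
qed

end
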